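(* Let $X$ be a finite connected CW-complex and $\xi\in H^1(X;\mathbb{R})$ be nonzero. Write $n=\dim X$. If $-\xi\in \Sigma^k(X)$ for some $k\leq n$, then $\mathrm{Cat}(X,\xi)\leq n-k$.
   Context: A (continuous) closed 1-form $\omega$ on a topological space $X$ is a collection $\{f_U\}_{U\in\mathcal{U}}$ of continuous functions $f_U:U\to\mathbb{R}$, where $\mathcal{U}$ is an open cover of $X$, such that $f_U-f_V$ is locally constant on $U\cap V$ for all $U,V\in\mathcal{U}$. It is integrated along a path $\gamma:[a,b]\to X$ by $\int_\gamma\omega=\sum_i (f_{U_i}(\gamma(t_{i+1}))-f_{U_i}(\gamma(t_i)))$ for any subdivision $a=t_0<\dots<t_m=b$ with $\gamma([t_i,t_{i+1}])\subset U_i\in\mathcal{U}$. Integration along loops defines a homomorphism $\xi_\omega:\pi_1(X)\to\mathbb{R}$; $\omega$ represents $\xi\in H^1(X;\mathbb{R})=\mathrm{Hom}(\pi_1(X),\mathbb{R})$ if $\xi_\omega=\xi$. Every $\xi$ is represented by some closed 1-form. For a finite connected CW-complex $X$, a nonzero $\xi\in H^1(X;\mathbb{R})$ and an integer $k\ge 0$, one writes $\xi\in\Sigma^k(X)$ if, for a closed 1-form $\omega$ on $X$ representing $\xi$, there are $\varepsilon>0$ and a cellular homotopy $H:X^{(k)}\times[0,1]\to X$ (a cellular map for the standard cell structure of $[0,1]$) with $H(x,0)=x$ and $\int_{\gamma_x}\omega\ge\varepsilon$ for all $x\in X^{(k)}$, where $\gamma_x(t)=H(x,t)$ and $X^{(k)}$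 is the $k$-skeleton. This is independent of $\omega$ and unchanged when $\xi$ is replaced by a positive multiple. For $A\subset X$, $\mathrm{cat}_X(A)$ is the minimal number $i$ such that there exist open sets $U_1,\dots,U_i\subset X$ covering $A$, each of which is null-homotopic in $X$ (i.e. the inclusion $U_j\to X$ is null-homotopic). $\mathrm{Cat}(X,\xi)$: fix a closed 1-form $\omega$ representing $\xi$. Then $\mathrm{Cat}(X,\xi)$ is the minimal integer $k$ such that there exists an open subset $U\subset X$ satisfying: (i) $\mathrm{cat}_X(X-U)\le k$; (ii) for some homotopy $h:U\times[0,\infty)\to X$ one has $h(x,0)=x$ and $\lim_{t\to\infty}\int_x^{h_t(x)}\omega=-\infty$ for every $x\in U$, where the integral is taken along the path $\tau\mapsto h(x,\tau)$, $\tau\in[0,t]$; (iii) the limit in (ii) is uniform in $x\in U$. *)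

theory Defs
  imports "HOL-Analysis.Analysis" "HOL-Algebra.Group"
begin

text \<open>The closed unit disk, its boundary sphere and its interior, inside the standard copy of
  \<open>n\<close>-dimensional Euclidean space in the type \<open>nat \<Rightarrow> real\<close>. For \<open>n = 0\<close>
  the disk is a point and the sphere is empty.\<close>

definition cdisk :: "nat \<Rightarrow> (nat \<Rightarrow> real) set" where
  "cdisk n = {x \<in> topspace (Euclidean_space n). (\<Sum>i<n. (x i)\<^sup>2) \<le> 1}"

definition odisk :: "nat \<Rightarrow> (nat \<Rightarrow> real) set" where
  "odisk n = {x \<in> topspace (Euclidean_space n). (\<Sum>i<n. (x i)\<^sup>2) < 1}"

definition bsphere :: "nat \<Rightarrow> (nat \<Rightarrow> real) set" where
  "bsphere n = {x \<in> topspace (Euclidean_space n). (\<Sum>i<n. (x i)\<^sup>2) = 1}"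

record ('a, 'e) cell_structure =
  cells :: "'e set"
  cell_dim :: "'e \<Rightarrow> nat"
  char_map :: "'e \<Rightarrow> (nat \<Rightarrow> real) \<Rightarrow> 'a"

definition open_cell :: "('a, 'e) cell_structure \<Rightarrow> 'e \<Rightarrow> 'a set" where
  "open_cell K e = char_map K e ` odisk (cell_dim K e)"

definition closed_cell :: "('a, 'e) cell_structure \<Rightarrow> 'e \<Rightarrow> 'a set" where
  "closed_cell K e = char_map K e ` cdisk (cell_dim K e)"

text \<open>The space is a subset \<open>X\<close> of an arbitrary topological space, with the subspace
  topology. The last two clauses are closure-finiteness and the weak topology.\<close>

definition cw_complex :: "'a::topological_space set \<Rightarrow> ('a, 'e) cell_structure \<Rightarrow> bool" where
  "cw_complex X K \<longleftrightarrow>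
     Hausdorff_space (top_of_set X) \<and>
     (\<forall>e\<in>cells K. continuous_on (cdisk (cell_dim K e)) (char_map K e) \<and>
        closed_cell K e \<subseteq> X \<and>
        (\<exists>g. homeomorphism (odisk (cell_dim K e)) (open_cell K e) (char_map K e) g)) \<and>
     X = (\<Union>e\<in>cells K. open_cell K e) \<and>
     disjoint_family_on (open_cell K) (cells K) \<and>
     (\<forall>e\<in>cells K. \<exists>F. finite F \<and> F \<subseteq> {e'\<in>cells K. cell_dim K e' < cell_dim K e} \<and>
        char_map K e ` bsphere (cell_dim K e) \<subseteq> (\<Union>e'\<in>F. open_cell K e')) \<and>
     (\<forall>A\<subseteq>X. closedin (top_of_set X) A \<longleftrightarrow>
        (\<forall>e\<in>cells K. closedin (top_of_set X) (A \<inter> closed_cell K e)))"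

definition finite_cw_complex :: "'a::topological_space set \<Rightarrow> ('a, 'e) cell_structure \<Rightarrow> bool" where
  "finite_cw_complex X K \<longleftrightarrow> cw_complex X K \<and> finite (cells K)"

definition cw_dim :: "('a, 'e) cell_structure \<Rightarrow> nat" where
  "cw_dim K = Max (cell_dim K ` cells K)"

definition skeleton :: "('a, 'e) cell_structure \<Rightarrow> nat \<Rightarrow> 'a set" where
  "skeleton K j = (\<Union>e\<in>{e\<in>cells K. cell_dim K e \<le> j}. open_cell K e)"

definition skeleton_complex :: "('a, 'e) cell_structure \<Rightarrow> nat \<Rightarrow> ('a, 'e) cell_structure" where
  "skeleton_complex K k = K\<lparr>cells := {e\<in>cells K. cell_dim K e \<le> k}\<rparr>"

text \<open>Skeleta of \<open>[0,1]\<close> with the two endpoints as \<open>0\<close>-cells, and skeleta of a product: the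
  product cells have dimension the sum of the dimensions of the factors.\<close>

definition interval_skeleton :: "nat \<Rightarrow> real set" where
  "interval_skeleton j = (if j = 0 then {0, 1} else {0..1})"

definition product_skeleton :: "(nat \<Rightarrow> 'a set) \<Rightarrow> (nat \<Rightarrow> 'b set) \<Rightarrow> nat \<Rightarrow> ('a \<times> 'b) set" where
  "product_skeleton S T j = (\<Union>i\<le>j. S i \<times> T (j - i))"

definition cellular :: "(nat \<Rightarrow> 'a set) \<Rightarrow> (nat \<Rightarrow> 'b set) \<Rightarrow> ('a \<Rightarrow> 'b) \<Rightarrow> bool" where
  "cellular S T f \<longleftrightarrow> (\<forall>j. f ` S j \<subseteq> T j)"

definition loops_at :: "'a::topological_space set \<Rightarrow> 'a \<Rightarrow> (real \<Rightarrow> 'a) set" where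
  "loops_at X x0 = {p. path p \<and> path_image p \<subseteq> X \<and> pathstart p = x0 \<and> pathfinish p = x0}"

definition loop_class :: "'a::topological_space set \<Rightarrow> (real \<Rightarrow> 'a) \<Rightarrow> (real \<Rightarrow> 'a) set" where
  "loop_class X p = {q. homotopic_paths X p q}"

definition fundamental_group :: "'a::topological_space set \<Rightarrow> 'a \<Rightarrow> (real \<Rightarrow> 'a) set monoid" where
  "fundamental_group X x0 =
     \<lparr>carrier = loop_class X ` loops_at X x0,
      mult = (\<lambda>P Q. \<Union>p\<in>P. \<Union>q\<in>Q. loop_class X (p +++ q)),
      one = loop_class X (\<lambda>_. x0)\<rparr>"

definition real_additive_group :: "real monoid" where
  "real_additive_group = \<lparr>carrier = UNIV, mult = (+), one = 0\<rparr>"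

definition H1 :: "'a::topological_space set \<Rightarrow> 'a \<Rightarrow> ((real \<Rightarrow> 'a) set \<Rightarrow> real) set" where
  "H1 X x0 = hom (fundamental_group X x0) real_additive_group"

text \<open>Elements of \<open>H1 X x0\<close> are only meaningful on the carrier of the fundamental group, so being
  nonzero is tested there.\<close>

definition nonzero_class :: "'a::topological_space set \<Rightarrow> 'a \<Rightarrow> ((real \<Rightarrow> 'a) set \<Rightarrow> real) \<Rightarrow> bool" where
  "nonzero_class X x0 \<xi> \<longleftrightarrow> (\<exists>g\<in>carrier (fundamental_group X x0). \<xi> g \<noteq> 0)"

lemma homotopic_paths_compose_unit:
  fixes p :: "real \<Rightarrow> 'a::topological_space"
  assumes "path p" "path_image p \<subseteq> S" "path \<phi>" "path \<psi>"
    and "path_image \<phi> \<subseteq> {0..1}" "path_image \<psi> \<subseteq> {0..1}"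
    and "pathstart \<phi> = pathstart \<psi>" "pathfinish \<phi> = pathfinish \<psi>"
  shows "homotopic_paths S (p \<circ> \<phi>) (p \<circ> \<psi>)"
proof (rule homotopic_paths_continuous_image)
  show "homotopic_paths {0..1} \<phi> \<psi>"
  proof (rule homotopic_paths_linear)
    show "closed_segment (\<phi> t) (\<psi> t) \<subseteq> {0..1}" if "t \<in> {0..1}" for t
    proof -
      have "\<phi> t \<in> {0..1}" "\<psi> t \<in> {0..1}"
        using that assms(5,6) unfolding path_image_def by blast+
      then show ?thesis by (intro closed_segment_subset) auto
    qed
  qed (use assms in auto)
  show "continuous_on {0..1} p" "p \<in> {0..1} \<rightarrow> S"
    using assms(1,2) by (auto simp: path_def path_image_def)
qed

lemma loop_class_eq_iff:
  assumes "p \<in> loops_at X x0"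
  shows "loop_class X p = loop_class X q \<longleftrightarrow> homotopic_paths X p q"
proof
  assume "loop_class X p = loop_class X q"
  then have "p \<in> loop_class X q" using assms by (auto simp: loop_class_def loops_at_def)
  then show "homotopic_paths X p q" by (simp add: loop_class_def homotopic_paths_sym)
next
  assume "homotopic_paths X p q"
  then show "loop_class X p = loop_class X q"
    unfolding loop_class_def by (auto intro: homotopic_paths_trans homotopic_paths_sym)
qed

lemma join_loops_at:
  "p \<in> loops_at X x0 \<Longrightarrow> q \<in> loops_at X x0 \<Longrightarrow> p +++ q \<in> loops_at X x0"
  by (auto simp: loops_at_def path_image_join)

lemma loop_class_mult:
  assumes p: "p \<in> loops_at X x0" and q: "q \<in> loops_at X x0"
  shows "loop_class X p \<otimes>\<^bsub>fundamental_group X x0\<^esub> loop_class X q = loop_class X (p +++ q)"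
proof -
  have "loop_class X (p' +++ q') = loop_class X (p +++ q)"
    if "p' \<in> loop_class X p" "q' \<in> loop_class X q" for p' q'
  proof -
    have "homotopic_paths X (p +++ q) (p' +++ q')"
      using that p q by (intro homotopic_paths_join) (auto simp: loop_class_def loops_at_def)
    then show ?thesis using loop_class_eq_iff[OF join_loops_at[OF p q]] by blast
  qed
  moreover have "p \<in> loop_class X p" "q \<in> loop_class X q"
    using p q by (auto simp: loop_class_def loops_at_def)
  ultimately have "(\<Union>p'\<in>loop_class X p. \<Union>q'\<in>loop_class X q. loop_class X (p' +++ q'))
      = loop_class X (p +++ q)"
    by (intro equalityI UN_least) blast+
  then show ?thesis by (simp add: fundamental_group_def)
qed

lemma group_fundamental_group:
  assumes "x0 \<in> X"
  shows "group (fundamental_group X x0)"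
proof -
  let ?G = "fundamental_group X x0" and ?L = "loops_at X x0" and ?c = "(\<lambda>_. x0) :: real \<Rightarrow> _"
  have carr: "carrier ?G = loop_class X ` ?L" and one: "\<one>\<^bsub>?G\<^esub> = loop_class X ?c"
    by (simp_all add: fundamental_group_def)
  have c: "?c \<in> ?L"
    using assms by (auto simp: loops_at_def path_def path_image_def pathstart_def pathfinish_def)
  note unit = path_def path_image_def pathstart_def pathfinish_def
  show ?thesis
  proof (rule groupI)
    show "\<one>\<^bsub>?G\<^esub> \<in> carrier ?G" using c by (auto simp: carr one)
  next
    fix a b assume "a \<in> carrier ?G" "b \<in> carrier ?G"
    then show "a \<otimes>\<^bsub>?G\<^esub> b \<in> carrier ?G"
      by (auto simp: carr loop_class_mult join_loops_at)
  next
    fix a b d assume "a \<in> carrier ?G" "b \<in> carrier ?G" "d \<in> carrier ?G"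
    then obtain p q r where *: "p \<in> ?L" "q \<in> ?L" "r \<in> ?L"
      and abd: "a = loop_class X p" "b = loop_class X q" "d = loop_class X r"
      by (auto simp: carr)
    have "homotopic_paths X ((p +++ q) +++ r) (p +++ (q +++ r))"
      using * by (intro homotopic_paths_sym[OF homotopic_paths_assoc]) (auto simp: loops_at_def)
    then show "a \<otimes>\<^bsub>?G\<^esub> b \<otimes>\<^bsub>?G\<^esub> d = a \<otimes>\<^bsub>?G\<^esub> (b \<otimes>\<^bsub>?G\<^esub> d)"
      using * by (simp add: abd loop_class_mult join_loops_at loop_class_eq_iff[where ?x0.0 = x0])
  next
    fix a assume "a \<in> carrier ?G"
    then obtain p where p: "p \<in> ?L" and a: "a = loop_class X p" by (auto simp: carr)
    have p': "path p" "path_image p \<subseteq> X" "p 0 = x0" "p 1 = x0"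
      using p by (auto simp: loops_at_def pathstart_def pathfinish_def)
    have "homotopic_paths X (p \<circ> (\<lambda>s. max 0 (2 * s - 1))) (p \<circ> (\<lambda>s. s))"
      by (rule homotopic_paths_compose_unit) (use p' in \<open>auto simp: unit intro!: continuous_intros\<close>)
    moreover have "p \<circ> (\<lambda>s. max 0 (2 * s - 1)) = ?c +++ p"
    proof
      fix s :: real
      show "(p \<circ> (\<lambda>s. max 0 (2 * s - 1))) s = (?c +++ p) s"
        using p' by (cases "s \<le> 1/2") (simp_all add: joinpaths_def max_absorb1 max_absorb2)
    qed
    ultimately have "homotopic_paths X (?c +++ p) p" by (simp add: o_def)
    then show "\<one>\<^bsub>?G\<^esub> \<otimes>\<^bsub>?G\<^esub> a = a"
      using p c by (simp add: a one loop_class_mult join_loops_at loop_class_eq_iff[where ?x0.0 = x0])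
    let ?r = "reversepath p"
    have r: "?r \<in> ?L" using p by (auto simp: loops_at_def)
    have "homotopic_paths X (p \<circ> (\<lambda>s. max (1 - 2 * s) (2 * s - 1))) (p \<circ> (\<lambda>s. 1))"
      by (rule homotopic_paths_compose_unit) (use p' in \<open>auto simp: unit intro!: continuous_intros\<close>)
    moreover have "p \<circ> (\<lambda>s. max (1 - 2 * s) (2 * s - 1)) = ?r +++ p"
    proof
      fix s :: real
      show "(p \<circ> (\<lambda>s. max (1 - 2 * s) (2 * s - 1))) s = (?r +++ p) s"
        by (cases "s \<le> 1/2") (simp_all add: joinpaths_def reversepath_def max_absorb1 max_absorb2)
    qed
    ultimately have "homotopic_paths X (?r +++ p) ?c" using p' by (simp add: o_def)
    then have "loop_class X ?r \<otimes>\<^bsub>?G\<^esub> a = \<one>\<^bsub>?G\<^esub>"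
      using p r by (simp add: a one loop_class_mult join_loops_at loop_class_eq_iff[where ?x0.0 = x0])
    then show "\<exists>b\<in>carrier ?G. b \<otimes>\<^bsub>?G\<^esub> a = \<one>\<^bsub>?G\<^esub>" using r by (auto simp: carr)
  qed
qed

lemma group_real_additive_group: "group real_additive_group"
proof (rule groupI)
  fix x assume "x \<in> carrier real_additive_group"
  show "\<exists>y\<in>carrier real_additive_group. y \<otimes>\<^bsub>real_additive_group\<^esub> x = \<one>\<^bsub>real_additive_group\<^esub>"
    by (rule bexI[of _ "- x"]) (simp_all add: real_additive_group_def)
qed (simp_all add: real_additive_group_def)

record 'a one_form =
  cover :: "'a set set"
  primitive :: "'a set \<Rightarrow> 'a \<Rightarrow> real"

definition locally_constant_on :: "'a::topological_space set \<Rightarrow> ('a \<Rightarrow> 'b) \<Rightarrow> bool" where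
  "locally_constant_on W f \<longleftrightarrow>
     (\<forall>x\<in>W. \<exists>N. openin (top_of_set W) N \<and> x \<in> N \<and> f constant_on N)"

definition closed_one_form :: "'a::topological_space set \<Rightarrow> 'a one_form \<Rightarrow> bool" where
  "closed_one_form X \<omega> \<longleftrightarrow>
     \<Union>(cover \<omega>) = X \<and>
     (\<forall>U\<in>cover \<omega>. openin (top_of_set X) U \<and> continuous_on U (primitive \<omega> U)) \<and>
     (\<forall>U\<in>cover \<omega>. \<forall>V\<in>cover \<omega>.
        locally_constant_on (U \<inter> V) (\<lambda>x. primitive \<omega> U x - primitive \<omega> V x))"

text \<open>\<open>I\<close> is the integral computed from some subdivision \<open>a = t 0 < \<dots> < t m = b\<close> that is
  subordinate to the cover. For a closed 1-form and a path it does not depend on the subdivision.\<close>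

definition has_form_integral ::
    "'a one_form \<Rightarrow> real \<Rightarrow> real \<Rightarrow> (real \<Rightarrow> 'a) \<Rightarrow> real \<Rightarrow> bool" where
  "has_form_integral \<omega> a b \<gamma> I \<longleftrightarrow>
     (\<exists>m t U. t 0 = a \<and> t m = b \<and>
        (\<forall>i<m. t i < t (Suc i) \<and> U i \<in> cover \<omega> \<and> \<gamma> ` {t i..t (Suc i)} \<subseteq> U i) \<and>
        I = (\<Sum>i<m. primitive \<omega> (U i) (\<gamma> (t (Suc i))) - primitive \<omega> (U i) (\<gamma> (t i))))"

definition form_integral :: "'a one_form \<Rightarrow> real \<Rightarrow> real \<Rightarrow> (real \<Rightarrow> 'a) \<Rightarrow> real" where
  "form_integral \<omega> a b \<gamma> = (THE I. has_form_integral \<omega> a b \<gamma> I)"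

definition represents ::
    "'a::topological_space set \<Rightarrow> 'a \<Rightarrow> 'a one_form \<Rightarrow> ((real \<Rightarrow> 'a) set \<Rightarrow> real) \<Rightarrow> bool" where
  "represents X x0 \<omega> \<xi> \<longleftrightarrow>
     closed_one_form X \<omega> \<and> (\<forall>p\<in>loops_at X x0. form_integral \<omega> 0 1 p = \<xi> (loop_class X p))"

text \<open>The condition does not depend on the representing form, so an existential quantifier is used.\<close>

definition Sigma_inv ::
    "'a::topological_space set \<Rightarrow> ('a, 'e) cell_structure \<Rightarrow> 'a \<Rightarrow> nat \<Rightarrow>
      ((real \<Rightarrow> 'a) set \<Rightarrow> real) set" where
  "Sigma_inv X K x0 k =
     {\<xi> \<in> H1 X x0. nonzero_class X x0 \<xi> \<and>
        (\<exists>\<omega>. represents X x0 \<omega> \<xi> \<and>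
           (\<exists>\<epsilon>>0. \<exists>H :: 'a \<times> real \<Rightarrow> 'a.
              continuous_on (skeleton K k \<times> {0..1}) H \<and>
              H ` (skeleton K k \<times> {0..1}) \<subseteq> X \<and>
              cellular (product_skeleton (skeleton (skeleton_complex K k)) interval_skeleton)
                (skeleton K) H \<and>
              (\<forall>x\<in>skeleton K k. H (x, 0) = x \<and> form_integral \<omega> 0 1 (\<lambda>t. H (x, t)) \<ge> \<epsilon>)))}"

definition null_homotopic_in :: "'a::topological_space set \<Rightarrow> 'a set \<Rightarrow> bool" where
  "null_homotopic_in X U \<longleftrightarrow> (\<exists>c. homotopic_with_canon (\<lambda>_. True) U X (\<lambda>x. x) (\<lambda>_. c))"

text \<open>Minima are taken in \<open>enat\<close>; the value is \<open>\<infinity>\<close> if no admissible integer exists.\<close>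

definition cat_in :: "'a::topological_space set \<Rightarrow> 'a set \<Rightarrow> enat" where
  "cat_in X A = Inf {enat i | i. \<exists>U :: nat \<Rightarrow> 'a set.
     (\<forall>j<i. openin (top_of_set X) (U j) \<and> null_homotopic_in X (U j)) \<and> A \<subseteq> (\<Union>j<i. U j)}"

definition Cat_form :: "'a::topological_space set \<Rightarrow> 'a one_form \<Rightarrow> enat" where
  "Cat_form X \<omega> = Inf {enat k | k. \<exists>U. openin (top_of_set X) U \<and>
     cat_in X (X - U) \<le> enat k \<and>
     (\<exists>h :: 'a \<times> real \<Rightarrow> 'a.
        continuous_on (U \<times> {0..}) h \<and> h ` (U \<times> {0..}) \<subseteq> X \<and>
        (\<forall>x\<in>U. h (x, 0) = x \<and>
           filterlim (\<lambda>t. form_integral \<omega> 0 t (\<lambda>\<tau>. h (x, \<tau>))) at_bot at_top) \<and>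
        (\<forall>C. \<forall>\<^sub>F t in at_top. \<forall>x\<in>U. form_integral \<omega> 0 t (\<lambda>\<tau>. h (x, \<tau>)) \<le> C))}"

text \<open>Any representing form may be chosen here; the value does not depend on the choice.\<close>

definition Cat ::
    "'a::topological_space set \<Rightarrow> 'a \<Rightarrow> ((real \<Rightarrow> 'a) set \<Rightarrow> real) \<Rightarrow> enat" where
  "Cat X x0 \<xi> = Cat_form X (SOME \<omega>. represents X x0 \<omega> \<xi>)"

end

theory Submission
  imports Defs
begin

text \<open>The \<open>k\<close>-skeleton has an open neighbourhood \<open>U\<close> that deforms into the skeleton inside
  \<open>X\<close>: open sets of a subcomplex are thickened one cell at a time, by pushing punctured cells
  radially to their boundary. Shrinking \<open>U\<close> to have compact closure, the form integrals along the
  deformation stay bounded. Once in the skeleton, one repeats the homotopy given by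
  \<open>-\<xi> \<in> \<Sigma>\<^sup>k(X)\<close>, whose end map preserves the skeleton; each round changes the integral by at
  least \<open>\<epsilon>\<close>. Passing to another form in the same class changes integrals only by a bounded amount.
  What remains is covered by the thickenings of \<open>X\<^sup>(\<^sup>d\<^sup>) - X\<^sup>(\<^sup>d\<^sup>-\<^sup>1\<^sup>)\<close>, for
  \<open>k < d \<le> n\<close>. Each of them deforms to a disjoint union of open cells and is therefore
  null-homotopic in the path-connected space \<open>X\<close>.\<close>

section \<open>Integrals of closed 1-forms\<close>

text \<open>\<open>Cat\<close> picks an unspecified representative of \<xi>, while the homotopy
  behind -\<xi> comes with a form of its own. Negating that form shows that \<xi> has a
  representative at all; the picked one is then compared with the given one through periods only. A
  path is closed up to a loop by two members of a system of paths joining \<open>x0\<close> to all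
  points of X. The system is not continuous, but its integrals are bounded, and bounded errors are
  harmless for divergence to -\<infinity>. Likewise every estimate has the shape t * \<epsilon> - A
  with A independent of the point, which gives uniformity on U although U need not be compact.

  The integral is a definite description over subordinate subdivisions. To compute with it, a path
  is given a primitive F: a real function whose difference with each local primitive f_U along the
  path is locally constant wherever the path lies in U. The rules for integrals then reduce to F b -
  F a.

  There is no metric on X: sets are recognised as closed by being compact in a Hausdorff space, and
  subdivisions come from bisecting the time interval.\<close>

definition form_primitive ::
    "'a one_form \<Rightarrow> (real \<Rightarrow> 'a) \<Rightarrow> real set \<Rightarrow> (real \<Rightarrow> real) \<Rightarrow> bool" where
  "form_primitive \<omega> \<gamma> S F \<longleftrightarrow>
     (\<forall>s\<in>S. \<forall>U\<in>cover \<omega>. \<gamma> s \<in> U \<longrightarrow>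
        (\<exists>T. open T \<and> s \<in> T \<and>
          (\<forall>s'\<in>S \<inter> T. F s' - primitive \<omega> U (\<gamma> s') = F s - primitive \<omega> U (\<gamma> s))))"

lemma form_primitiveE:
  assumes "form_primitive \<omega> \<gamma> S F" "s \<in> S" "U \<in> cover \<omega>" "\<gamma> s \<in> U"
  obtains T where "open T" "s \<in> T"
    "\<And>s'. s' \<in> S \<Longrightarrow> s' \<in> T \<Longrightarrow> F s' - primitive \<omega> U (\<gamma> s') = F s - primitive \<omega> U (\<gamma> s)"
proof -
  have "\<exists>T. open T \<and> s \<in> T \<and>
      (\<forall>s'\<in>S \<inter> T. F s' - primitive \<omega> U (\<gamma> s') = F s - primitive \<omega> U (\<gamma> s))"
    using assms unfolding form_primitive_def by simp
  then show ?thesis using that by blast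
qed

lemma form_primitive_subset:
  assumes "form_primitive \<omega> \<gamma> S F" "S' \<subseteq> S"
  shows "form_primitive \<omega> \<gamma> S' F"
  unfolding form_primitive_def
proof (intro ballI impI)
  fix s U assume "s \<in> S'" "U \<in> cover \<omega>" "\<gamma> s \<in> U"
  moreover from this have "s \<in> S" using assms(2) by blast
  ultimately obtain T where "open T" "s \<in> T"
    "\<And>s'. s' \<in> S \<Longrightarrow> s' \<in> T \<Longrightarrow> F s' - primitive \<omega> U (\<gamma> s') = F s - primitive \<omega> U (\<gamma> s)"
    using form_primitiveE[OF assms(1)] by metis
  then show "\<exists>T. open T \<and> s \<in> T \<and>
      (\<forall>s'\<in>S' \<inter> T. F s' - primitive \<omega> U (\<gamma> s') = F s - primitive \<omega> U (\<gamma> s))"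
    using assms(2) by (intro exI[of _ T]) auto
qed

lemma closed_one_form_coverE:
  assumes "closed_one_form X \<omega>" "x \<in> X"
  obtains U where "U \<in> cover \<omega>" "x \<in> U" "openin (top_of_set X) U"
proof -
  have "x \<in> \<Union>(cover \<omega>)" using assms by (simp add: closed_one_form_def)
  then obtain U where "U \<in> cover \<omega>" "x \<in> U" by auto
  moreover have "openin (top_of_set X) U"
    using assms(1) \<open>U \<in> cover \<omega>\<close> by (simp add: closed_one_form_def)
  ultimately show ?thesis by (rule that)
qed

text \<open>The condition at a point only involves a neighbourhood of it, which can be pulled back
  under \<phi>. Since \<phi> may run in any direction, this serves both reparametrisation and
  reversal.\<close>

lemma form_primitive_compose:
  assumes "form_primitive \<omega> \<gamma> S F" "continuous_on S' \<phi>" "\<phi> ` S' \<subseteq> S"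
  shows "form_primitive \<omega> (\<lambda>s. \<gamma> (\<phi> s)) S' (\<lambda>s. F (\<phi> s))"
  unfolding form_primitive_def
proof (intro ballI impI)
  fix s U assume s: "s \<in> S'" and U: "U \<in> cover \<omega>" "\<gamma> (\<phi> s) \<in> U"
  have "\<phi> s \<in> S" using s assms(3) by auto
  from form_primitiveE[OF assms(1) this U] obtain T where T: "open T" "\<phi> s \<in> T"
    "\<And>s'. s' \<in> S \<Longrightarrow> s' \<in> T \<Longrightarrow>
      F s' - primitive \<omega> U (\<gamma> s') = F (\<phi> s) - primitive \<omega> U (\<gamma> (\<phi> s))"
    by blast
  obtain T' where T': "open T'" "T' \<inter> S' = \<phi> -` T \<inter> S'"
    using assms(2) T(1) unfolding continuous_on_open_invariant by blast
  have "\<phi> s' \<in> S \<and> \<phi> s' \<in> T" if "s' \<in> S' \<inter> T'" for s'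
    using that T' assms(3) by blast
  moreover have "s \<in> T'" using s T T' by blast
  ultimately show "\<exists>T. open T \<and> s \<in> T \<and>
      (\<forall>s'\<in>S' \<inter> T. F (\<phi> s') - primitive \<omega> U (\<gamma> (\<phi> s')) =
        F (\<phi> s) - primitive \<omega> U (\<gamma> (\<phi> s)))"
    using T'(1) T(3) by (intro exI[of _ T'] conjI ballI) auto
qed

text \<open>Inside one cover set the local primitive itself works. At a point that also lies in
  another cover set V, local constancy of f_U - f_V supplies the neighbourhood; this is how
  closedness of the form enters the integral.\<close>

lemma form_primitive_within_cover:
  assumes "closed_one_form X \<omega>" "continuous_on S \<gamma>" "\<gamma> ` S \<subseteq> U" "U \<in> cover \<omega>"
  shows "form_primitive \<omega> \<gamma> S (\<lambda>s. primitive \<omega> U (\<gamma> s))"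
  unfolding form_primitive_def
proof (intro ballI impI)
  fix s V assume s: "s \<in> S" and V: "V \<in> cover \<omega>" "\<gamma> s \<in> V"
  have UV: "openin (top_of_set X) U" "openin (top_of_set X) V"
    using assms V by (auto simp: closed_one_form_def)
  have "locally_constant_on (U \<inter> V) (\<lambda>x. primitive \<omega> U x - primitive \<omega> V x)"
    using assms V by (auto simp: closed_one_form_def)
  then obtain N where N: "openin (top_of_set (U \<inter> V)) N" "\<gamma> s \<in> N"
      "(\<lambda>x. primitive \<omega> U x - primitive \<omega> V x) constant_on N"
    using s V assms(3) unfolding locally_constant_on_def by blast
  have "openin (top_of_set X) N"
    using N(1) UV by (meson openin_Int openin_trans)
  moreover have "\<gamma> ` S \<subseteq> X" using assms UV(1) openin_imp_subset by blast
  ultimately have "openin (top_of_set S) (S \<inter> \<gamma> -` N)"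
    using assms(2) by (simp add: continuous_on_open_gen image_subset_iff_funcset)
  then obtain T where T: "open T" "S \<inter> \<gamma> -` N = S \<inter> T"
    by (auto simp: openin_open)
  have "primitive \<omega> U (\<gamma> s') - primitive \<omega> V (\<gamma> s') = primitive \<omega> U (\<gamma> s) - primitive \<omega> V (\<gamma> s)"
    if "s' \<in> S \<inter> T" for s'
  proof -
    have "\<gamma> s' \<in> N" using that T by blast
    then show ?thesis using N by (auto simp: constant_on_def)
  qed
  moreover have "s \<in> T" using T s N by blast
  ultimately show "\<exists>T. open T \<and> s \<in> T \<and> (\<forall>s'\<in>S \<inter> T. primitive \<omega> U (\<gamma> s') - primitive \<omega> V (\<gamma> s') =
      primitive \<omega> U (\<gamma> s) - primitive \<omega> V (\<gamma> s))"
    using T by blast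
qed

text \<open>G is shifted by F b - G b so that both pieces agree at b. Away from b the neighbourhood
  is cut down to one side of b; at b the neighbourhoods from both sides are intersected.\<close>

lemma form_primitive_concat:
  assumes F: "form_primitive \<omega> \<gamma> {a..b} F" and G: "form_primitive \<omega> \<gamma> {b..c} G"
    and "a \<le> b" "b \<le> c"
  shows "form_primitive \<omega> \<gamma> {a..c} (\<lambda>s. if s \<le> b then F s else G s + F b - G b)"
  unfolding form_primitive_def
proof (intro ballI impI)
  fix s U assume s: "s \<in> {a..c}" and U: "U \<in> cover \<omega>" "\<gamma> s \<in> U"
  let ?H = "\<lambda>s. if s \<le> b then F s else G s + F b - G b"
  have left: "\<exists>T. open T \<and> s \<in> T \<and> (\<forall>s'\<in>{a..b} \<inter> T. ?H s' - primitive \<omega> U (\<gamma> s') =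
      ?H s - primitive \<omega> U (\<gamma> s))" if "s \<le> b"
  proof -
    have "s \<in> {a..b}" using that s by auto
    from form_primitiveE[OF F this U] obtain T where "open T" "s \<in> T"
        "\<And>s'. s' \<in> {a..b} \<Longrightarrow> s' \<in> T \<Longrightarrow> F s' - primitive \<omega> U (\<gamma> s') = F s - primitive \<omega> U (\<gamma> s)"
      by blast
    then show ?thesis using that by (intro exI[of _ T]) auto
  qed
  have right: "\<exists>T. open T \<and> s \<in> T \<and> (\<forall>s'\<in>{b..c} \<inter> T. ?H s' - primitive \<omega> U (\<gamma> s') =
      ?H s - primitive \<omega> U (\<gamma> s))" if "b \<le> s"
  proof -
    have H: "?H r = G r + F b - G b" if "b \<le> r" for r using that by auto
    have "s \<in> {b..c}" using that s by auto
    from form_primitiveE[OF G this U] obtain T where T: "open T" "s \<in> T"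
        "\<And>s'. s' \<in> {b..c} \<Longrightarrow> s' \<in> T \<Longrightarrow> G s' - primitive \<omega> U (\<gamma> s') = G s - primitive \<omega> U (\<gamma> s)"
      by blast
    have "?H s' - primitive \<omega> U (\<gamma> s') = ?H s - primitive \<omega> U (\<gamma> s)" if "s' \<in> {b..c} \<inter> T" for s'
      using T(3)[of s'] that H[of s'] H[of s] \<open>b \<le> s\<close> by simp
    then show ?thesis using T(1,2) by blast
  qed
  consider "s < b" | "s > b" | "s = b" by linarith
  then show "\<exists>T. open T \<and> s \<in> T \<and> (\<forall>s'\<in>{a..c} \<inter> T.
      ?H s' - primitive \<omega> U (\<gamma> s') = ?H s - primitive \<omega> U (\<gamma> s))"
  proof cases
    case 1
    with left obtain T where "open T" "s \<in> T"
        "\<forall>s'\<in>{a..b} \<inter> T. ?H s' - primitive \<omega> U (\<gamma> s') = ?H s - primitive \<omega> U (\<gamma> s)"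
      by (meson less_imp_le)
    moreover have "{a..c} \<inter> (T \<inter> {..<b}) \<subseteq> {a..b} \<inter> T" by auto
    ultimately show ?thesis using 1
      by (intro exI[of _ "T \<inter> {..<b}"] conjI open_Int) (blast | simp)+
  next
    case 2
    with right obtain T where "open T" "s \<in> T"
        "\<forall>s'\<in>{b..c} \<inter> T. ?H s' - primitive \<omega> U (\<gamma> s') = ?H s - primitive \<omega> U (\<gamma> s)"
      by (meson less_imp_le)
    moreover have "{a..c} \<inter> (T \<inter> {b<..}) \<subseteq> {b..c} \<inter> T" by auto
    ultimately show ?thesis using 2
      by (intro exI[of _ "T \<inter> {b<..}"] conjI open_Int) (blast | simp)+
  next
    case 3
    with left obtain T where T: "open T" "s \<in> T"
        "\<forall>s'\<in>{a..b} \<inter> T. ?H s' - primitive \<omega> U (\<gamma> s') = ?H s - primitive \<omega> U (\<gamma> s)"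
      by (meson order_refl)
    from 3 right obtain T' where T': "open T'" "s \<in> T'"
        "\<forall>s'\<in>{b..c} \<inter> T'. ?H s' - primitive \<omega> U (\<gamma> s') = ?H s - primitive \<omega> U (\<gamma> s)"
      by (meson order_refl)
    have "\<forall>s'\<in>{a..c} \<inter> (T \<inter> T'). ?H s' - primitive \<omega> U (\<gamma> s') = ?H s - primitive \<omega> U (\<gamma> s)"
    proof
      fix s' assume "s' \<in> {a..c} \<inter> (T \<inter> T')"
      then have "s' \<in> {a..b} \<inter> T \<or> s' \<in> {b..c} \<inter> T'" by auto
      then show "?H s' - primitive \<omega> U (\<gamma> s') = ?H s - primitive \<omega> U (\<gamma> s)"
        using T(3) T'(3) by blast
    qed
    then show ?thesis using T T' by (meson IntI open_Int)
  qed
qed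

text \<open>This is the local hypothesis of a bisection argument: short intervals around x are
  mapped into a single cover set. The intersection with {a..b} allows for intervals that stick out
  of the domain.\<close>

lemma local_cover_interval:
  fixes \<gamma> :: "real \<Rightarrow> 'a::topological_space"
  assumes "closed_one_form X \<omega>" "continuous_on {a..b} \<gamma>" "\<gamma> ` {a..b} \<subseteq> X" "x \<in> {a..b}"
  obtains d U where "d > 0" "U \<in> cover \<omega>"
    "\<And>a' b'. a' \<le> x \<Longrightarrow> x \<le> b' \<Longrightarrow> b' - a' < d \<Longrightarrow> \<gamma> ` ({a'..b'} \<inter> {a..b}) \<subseteq> U"
proof -
  have "\<gamma> x \<in> X" using assms by auto
  with assms(1) obtain U where U: "U \<in> cover \<omega>" "\<gamma> x \<in> U" "openin (top_of_set X) U"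
    by (rule closed_one_form_coverE)
  have "openin (top_of_set {a..b}) ({a..b} \<inter> \<gamma> -` U)"
    using assms U by (simp add: continuous_on_open_gen image_subset_iff_funcset)
  then obtain T where T: "open T" "{a..b} \<inter> \<gamma> -` U = {a..b} \<inter> T"
    by (auto simp: openin_open)
  have "x \<in> T" using T U assms by blast
  then obtain d where d: "d > 0" "ball x d \<subseteq> T"
    using T open_contains_ball by blast
  have "\<gamma> ` ({a'..b'} \<inter> {a..b}) \<subseteq> U" if "a' \<le> x" "x \<le> b'" "b' - a' < d" for a' b'
  proof -
    have "{a'..b'} \<subseteq> ball x d" using that by (auto simp: dist_real_def)
    then show ?thesis using d T by blast
  qed
  then show ?thesis using that d U by blast
qed

text \<open>Bisection: primitives on adjacent intervals can be glued, and on short intervals a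
  single cover set provides one.\<close>

lemma form_primitive_exists:
  assumes "closed_one_form X \<omega>" "continuous_on {a..b} \<gamma>" "\<gamma> ` {a..b} \<subseteq> X" "a \<le> b"
  obtains F where "form_primitive \<omega> \<gamma> {a..b} F"
proof -
  \<comment> \<open>The trivial premises are the instance, at the full interval, of the guard that
    confines the bisection to subintervals of {a..b}.\<close>
  have "a \<le> a \<and> b \<le> b \<longrightarrow> (\<exists>F. form_primitive \<omega> \<gamma> {a..b} F)"
  proof (rule Bolzano[where P = "\<lambda>c d. a \<le> c \<and> d \<le> b \<longrightarrow> (\<exists>F. form_primitive \<omega> \<gamma> {c..d} F)"])
    fix c d e :: real
    assume "a \<le> c \<and> d \<le> b \<longrightarrow> (\<exists>F. form_primitive \<omega> \<gamma> {c..d} F)"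
      "a \<le> d \<and> e \<le> b \<longrightarrow> (\<exists>F. form_primitive \<omega> \<gamma> {d..e} F)" "c \<le> d" "d \<le> e"
    then show "a \<le> c \<and> e \<le> b \<longrightarrow> (\<exists>F. form_primitive \<omega> \<gamma> {c..e} F)"
      using form_primitive_concat[of \<omega> \<gamma> c d] by (meson order_trans)
  next
    fix x assume "a \<le> x" "x \<le> b"
    then obtain d U where d: "d > 0" "U \<in> cover \<omega>"
      "\<And>a' b'. a' \<le> x \<Longrightarrow> x \<le> b' \<Longrightarrow> b' - a' < d \<Longrightarrow> \<gamma> ` ({a'..b'} \<inter> {a..b}) \<subseteq> U"
      using local_cover_interval[OF assms(1-3), of x] by auto
    show "\<exists>d>0. \<forall>c e. c \<le> x \<and> x \<le> e \<and> e - c < d \<longrightarrow>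
        a \<le> c \<and> e \<le> b \<longrightarrow> (\<exists>F. form_primitive \<omega> \<gamma> {c..e} F)"
    proof (rule exI[of _ d], intro conjI d allI impI; elim conjE)
      fix c e assume *: "c \<le> x" "x \<le> e" "e - c < d" "a \<le> c" "e \<le> b"
      then have "{c..e} \<inter> {a..b} = {c..e}" by auto
      then have "\<gamma> ` {c..e} \<subseteq> U" using d(3)[of c e] * by simp
      moreover have "continuous_on {c..e} \<gamma>"
        using assms(2) * by (auto intro: continuous_on_subset)
      ultimately show "\<exists>F. form_primitive \<omega> \<gamma> {c..e} F"
        using form_primitive_within_cover[OF assms(1)] d(2) by blast
    qed
  qed (use assms in auto)
  then show ?thesis using that by blast
qed

section \<open>Subdivision sums: existence and comparison with primitives\<close>

lemma has_form_integralE: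
  assumes "has_form_integral \<omega> a b \<gamma> I"
  obtains m t U where "t 0 = a" "t m = b"
    "\<forall>i<m. t i < t (Suc i) \<and> U i \<in> cover \<omega> \<and> \<gamma> ` {t i..t (Suc i)} \<subseteq> U i"
    "I = (\<Sum>i<m. primitive \<omega> (U i) (\<gamma> (t (Suc i))) - primitive \<omega> (U i) (\<gamma> (t i)))"
  using assms unfolding has_form_integral_def by (elim exE conjE) (rule that)

text \<open>Only existence is asserted, since the value is determined afterwards by comparison with
  a primitive.\<close>

lemma has_form_integral_concat:
  assumes "has_form_integral \<omega> a b \<gamma> I" "has_form_integral \<omega> b c \<gamma> J"
  shows "\<exists>I. has_form_integral \<omega> a c \<gamma> I"
proof -
  obtain m t U where 1: "t 0 = a" "t m = b"
      "\<forall>i<m. t i < t (Suc i) \<and> U i \<in> cover \<omega> \<and> \<gamma> ` {t i..t (Suc i)} \<subseteq> U i"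
    using assms(1) by (rule has_form_integralE)
  obtain m' t' U' where 2: "t' 0 = b" "t' m' = c"
      "\<forall>i<m'. t' i < t' (Suc i) \<and> U' i \<in> cover \<omega> \<and> \<gamma> ` {t' i..t' (Suc i)} \<subseteq> U' i"
    using assms(2) by (rule has_form_integralE)
  \<comment> \<open>Point m belongs to both subdivisions and is taken from the first, while interval
    number m is already the initial one of the second; hence \<open>\<le>\<close> for points and
    \<open><\<close> for cover sets.\<close>
  let ?t = "\<lambda>i. if i \<le> m then t i else t' (i - m)"
  let ?U = "\<lambda>i. if i < m then U i else U' (i - m)"
  have "?t i < ?t (Suc i) \<and> ?U i \<in> cover \<omega> \<and> \<gamma> ` {?t i..?t (Suc i)} \<subseteq> ?U i"
    if "i < m + m'" for i
  proof (cases "i < m")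
    case True then show ?thesis using 1(3) by simp
  next
    case False
    then have t: "?t i = t' (i - m)" "?t (Suc i) = t' (Suc (i - m))"
      using 1(2) 2(1) by (auto simp: Suc_diff_le)
    have "i - m < m'" using that False by simp
    then show ?thesis unfolding t using 2(3) False by simp
  qed
  moreover have "?t 0 = a" "?t (m + m') = c" using 1 2 by auto
  ultimately have "has_form_integral \<omega> a c \<gamma>
      (\<Sum>i<m + m'. primitive \<omega> (?U i) (\<gamma> (?t (Suc i))) - primitive \<omega> (?U i) (\<gamma> (?t i)))"
    unfolding has_form_integral_def
    by (intro exI[of _ "m + m'"] exI[of _ ?t] exI[of _ ?U] conjI refl allI impI) blast+
  then show ?thesis ..
qed

lemma has_form_integral_exists:
  assumes "closed_one_form X \<omega>" "continuous_on {a..b} \<gamma>" "\<gamma> ` {a..b} \<subseteq> X" "a \<le> b"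
  shows "\<exists>I. has_form_integral \<omega> a b \<gamma> I"
proof -
  have "a \<le> a \<and> b \<le> b \<longrightarrow> (\<exists>I. has_form_integral \<omega> a b \<gamma> I)"
  proof (rule Bolzano[where P = "\<lambda>c d. a \<le> c \<and> d \<le> b \<longrightarrow> (\<exists>I. has_form_integral \<omega> c d \<gamma> I)"])
    fix c d e :: real
    assume "a \<le> c \<and> d \<le> b \<longrightarrow> (\<exists>I. has_form_integral \<omega> c d \<gamma> I)"
      "a \<le> d \<and> e \<le> b \<longrightarrow> (\<exists>I. has_form_integral \<omega> d e \<gamma> I)" "c \<le> d" "d \<le> e"
    then show "a \<le> c \<and> e \<le> b \<longrightarrow> (\<exists>I. has_form_integral \<omega> c e \<gamma> I)"
      using has_form_integral_concat by (meson order_trans)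
  next
    fix x assume "a \<le> x" "x \<le> b"
    then obtain d U where d: "d > 0" "U \<in> cover \<omega>"
      "\<And>a' b'. a' \<le> x \<Longrightarrow> x \<le> b' \<Longrightarrow> b' - a' < d \<Longrightarrow> \<gamma> ` ({a'..b'} \<inter> {a..b}) \<subseteq> U"
      using local_cover_interval[OF assms(1-3), of x] by auto
    show "\<exists>d>0. \<forall>c e. c \<le> x \<and> x \<le> e \<and> e - c < d \<longrightarrow>
        a \<le> c \<and> e \<le> b \<longrightarrow> (\<exists>I. has_form_integral \<omega> c e \<gamma> I)"
    proof (rule exI[of _ d], intro conjI d allI impI; elim conjE)
      fix c e assume *: "c \<le> x" "x \<le> e" "e - c < d" "a \<le> c" "e \<le> b"
      then have "{c..e} \<inter> {a..b} = {c..e}" by auto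
      then have "\<gamma> ` {c..e} \<subseteq> U" using d(3)[of c e] * by simp
      \<comment> \<open>Subdivision points increase strictly, so a degenerate interval gets zero
        pieces instead of one.\<close>
      have "has_form_integral \<omega> c e \<gamma> (\<Sum>i<(if c = e then 0 else 1).
          primitive \<omega> U (\<gamma> (if Suc i = 0 then c else e)) -
          primitive \<omega> U (\<gamma> (if i = 0 then c else e)))"
        unfolding has_form_integral_def
        by (intro exI[of _ "if c = e then 0 else 1"] exI[of _ "\<lambda>i. if i = 0 then c else e"]
            exI[of _ "\<lambda>_. U"] conjI refl) (use d(2) * \<open>\<gamma> ` {c..e} \<subseteq> U\<close> in auto)
      then show "\<exists>I. has_form_integral \<omega> c e \<gamma> I" ..
    qed
  qed (use assms in auto)
  then show ?thesis by blast
qed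

text \<open>The difference of F and the local primitive is locally constant, hence constant on the
  connected interval.\<close>

lemma form_primitive_cover_diff:
  assumes "form_primitive \<omega> \<gamma> {a..b} F" "\<gamma> ` {a..b} \<subseteq> U" "U \<in> cover \<omega>" "a \<le> b"
  shows "primitive \<omega> U (\<gamma> b) - primitive \<omega> U (\<gamma> a) = F b - F a"
proof -
  have "F a - primitive \<omega> U (\<gamma> a) = F b - primitive \<omega> U (\<gamma> b)"
  proof (rule connected_local_const[where f = "\<lambda>s. F s - primitive \<omega> U (\<gamma> s)"])
    show "\<forall>s\<in>{a..b}. \<forall>\<^sub>F s' in at s within {a..b}.
        F s - primitive \<omega> U (\<gamma> s) = F s' - primitive \<omega> U (\<gamma> s')"
    proof
      fix s assume "s \<in> {a..b}"
      then obtain T where "open T" "s \<in> T"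
        "\<And>s'. s' \<in> {a..b} \<Longrightarrow> s' \<in> T \<Longrightarrow> F s' - primitive \<omega> U (\<gamma> s') = F s - primitive \<omega> U (\<gamma> s)"
        using form_primitiveE[OF assms(1) _ assms(3)] assms(2) by blast
      then show "\<forall>\<^sub>F s' in at s within {a..b}.
          F s - primitive \<omega> U (\<gamma> s) = F s' - primitive \<omega> U (\<gamma> s')"
        unfolding eventually_at_topological by metis
    qed
  qed (use assms in auto)
  then show ?thesis by simp
qed

text \<open>Each summand is an increment of F, so the sum telescopes. As F does not mention the
  subdivision, this is the independence of choices that makes the definite description in
  \<open>form_integral\<close> meaningful.\<close>

lemma has_form_integral_primitive:
  assumes "has_form_integral \<omega> a b \<gamma> I" "form_primitive \<omega> \<gamma> {a..b} F"
  shows "I = F b - F a"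
proof -
  obtain m t U where t: "t 0 = a" "t m = b"
      and "\<forall>i<m. t i < t (Suc i) \<and> U i \<in> cover \<omega> \<and> \<gamma> ` {t i..t (Suc i)} \<subseteq> U i"
      and I: "I = (\<Sum>i<m. primitive \<omega> (U i) (\<gamma> (t (Suc i))) - primitive \<omega> (U i) (\<gamma> (t i)))"
    using assms(1) by (rule has_form_integralE)
  then have tU: "t i < t (Suc i) \<and> U i \<in> cover \<omega> \<and> \<gamma> ` {t i..t (Suc i)} \<subseteq> U i" if "i < m" for i
    using that by blast
  have lo: "t 0 \<le> t i" if "i \<le> m" for i
    using that
  proof (induction i)
    case (Suc i)
    then show ?case using tU[of i] by simp
  qed simp
  have hi: "t i \<le> t m" if "i \<le> m" for i
    using that
  proof (induction rule: inc_induct)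
    case (step i)
    then show ?case using tU[of i] by simp
  qed simp
  have "primitive \<omega> (U i) (\<gamma> (t (Suc i))) - primitive \<omega> (U i) (\<gamma> (t i)) = F (t (Suc i)) - F (t i)"
    if "i < m" for i
    using tU[OF that] lo[of i] hi[of "Suc i"] t that
    by (intro form_primitive_cover_diff[OF form_primitive_subset[OF assms(2)]]) auto
  then show ?thesis unfolding I 
    using t sum_lessThan_telescope[of "\<lambda>i. F (t i)" m] by simp
qed

lemma form_integral_primitive:
  assumes "closed_one_form X \<omega>" "continuous_on {a..b} \<gamma>" "\<gamma> ` {a..b} \<subseteq> X" "a \<le> b"
    and "form_primitive \<omega> \<gamma> {a..b} F"
  shows "form_integral \<omega> a b \<gamma> = F b - F a"
  unfolding form_integral_def
  using has_form_integral_exists[OF assms(1-4)] has_form_integral_primitive[OF _ assms(5)]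
  by (intro the_equality) auto

section \<open>Rules of calculation for integrals along paths\<close>

lemma form_integral_reparam:
  assumes "closed_one_form X \<omega>" "continuous_on {a..b} \<gamma>" "\<gamma> ` {a..b} \<subseteq> X" "a \<le> b"
    and "continuous_on {c..d} \<phi>" "\<phi> ` {c..d} \<subseteq> {a..b}" "c \<le> d" "\<phi> c = a" "\<phi> d = b"
    and "\<And>s. s \<in> {c..d} \<Longrightarrow> \<delta> s = \<gamma> (\<phi> s)"
  shows "form_integral \<omega> c d \<delta> = form_integral \<omega> a b \<gamma>"
proof -
  obtain F where F: "form_primitive \<omega> \<gamma> {a..b} F"
    using form_primitive_exists assms by metis
  have "continuous_on {c..d} (\<gamma> \<circ> \<phi>)"
    using assms by (meson continuous_on_compose continuous_on_subset)
  then have *: "continuous_on {c..d} \<delta>"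
    by (rule continuous_on_eq) (use assms(10) in auto)
  have "form_primitive \<omega> \<delta> {c..d} (\<lambda>s. F (\<phi> s))"
    using form_primitive_compose[OF F assms(5,6)] assms(10) by (simp add: form_primitive_def)
  then have "form_integral \<omega> c d \<delta> = F (\<phi> d) - F (\<phi> c)"
    using assms * by (intro form_integral_primitive[of X]) force+
  then show ?thesis
    using form_integral_primitive[OF assms(1-4) F] assms(8,9) by simp
qed

lemma form_integral_cong:
  assumes "closed_one_form X \<omega>" "continuous_on {a..b} \<gamma>" "\<gamma> ` {a..b} \<subseteq> X" "a \<le> b"
    and "\<And>s. s \<in> {a..b} \<Longrightarrow> \<delta> s = \<gamma> s"
  shows "form_integral \<omega> a b \<delta> = form_integral \<omega> a b \<gamma>"
  by (rule form_integral_reparam[where \<phi> = "\<lambda>s. s"]) (use assms in auto)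

lemma form_integral_combine:
  assumes "closed_one_form X \<omega>" "continuous_on {a..c} \<gamma>" "\<gamma> ` {a..c} \<subseteq> X" "a \<le> b" "b \<le> c"
  shows "form_integral \<omega> a c \<gamma> = form_integral \<omega> a b \<gamma> + form_integral \<omega> b c \<gamma>"
proof -
  obtain F where F: "form_primitive \<omega> \<gamma> {a..c} F"
    using form_primitive_exists assms by (metis order_trans)
  have "form_integral \<omega> a' b' \<gamma> = F b' - F a'" if "a \<le> a'" "a' \<le> b'" "b' \<le> c" for a' b'
  proof -
    have "{a'..b'} \<subseteq> {a..c}" using that by auto
    then show ?thesis
      using assms form_primitive_subset[OF F] that
      by (intro form_integral_primitive[of X]) (auto intro: continuous_on_subset)
  qed
  then show ?thesis using assms by simp
qed

lemma form_integral_reverse: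
  assumes "closed_one_form X \<omega>" "path p" "path_image p \<subseteq> X"
  shows "form_integral \<omega> 0 1 (reversepath p) = - form_integral \<omega> 0 1 p"
proof -
  have p: "continuous_on {0..1} p" "p ` {0..1} \<subseteq> X"
    using assms by (auto simp: path_def path_image_def)
  obtain F where F: "form_primitive \<omega> p {0..1} F"
    using form_primitive_exists[OF assms(1) p] by auto
  have "form_primitive \<omega> (reversepath p) {0..1} (\<lambda>s. F (1 - s))"
    unfolding reversepath_def
    by (rule form_primitive_compose[OF F]) (auto intro!: continuous_intros)
  moreover have "path (reversepath p)" "path_image (reversepath p) \<subseteq> X"
    using assms by auto
  ultimately have "form_integral \<omega> 0 1 (reversepath p) = F 0 - F 1"
    using assms(1) form_integral_primitive[of X \<omega> 0 1 "reversepath p"]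
    by (auto simp: path_def path_image_def)
  then show ?thesis using form_integral_primitive[OF assms(1) p _ F] by simp
qed

lemma form_integral_join:
  assumes "closed_one_form X \<omega>" "path p" "path_image p \<subseteq> X" "path q" "path_image q \<subseteq> X"
    and "pathfinish p = pathstart q"
  shows "form_integral \<omega> 0 1 (p +++ q) = form_integral \<omega> 0 1 p + form_integral \<omega> 0 1 q"
proof -
  have pq: "path (p +++ q)" "path_image (p +++ q) \<subseteq> X"
    using assms by (auto simp: path_image_join)
  have "form_integral \<omega> 0 1 (p +++ q) =
      form_integral \<omega> 0 (1/2) (p +++ q) + form_integral \<omega> (1/2) 1 (p +++ q)"
    using pq assms(1) by (intro form_integral_combine) (auto simp: path_def path_image_def)
  moreover have "form_integral \<omega> 0 (1/2) (p +++ q) = form_integral \<omega> 0 1 p"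
    using assms by (intro form_integral_reparam[where \<phi> = "\<lambda>s. 2 * s"])
      (auto simp: path_def path_image_def joinpaths_def intro!: continuous_intros)
  moreover have "form_integral \<omega> (1/2) 1 (p +++ q) = form_integral \<omega> 0 1 q"
  proof (rule form_integral_reparam[where \<phi> = "\<lambda>s. 2 * s - 1"])
    show "(p +++ q) s = q (2 * s - 1)" if "s \<in> {1/2..1}" for s
    proof (cases "s = 1/2")
      \<comment> \<open>At 1/2 the joined path takes its value from p, so the matching of the end
        points is used here.\<close>
      case True
      show ?thesis
        unfolding True using assms(6) by (simp add: joinpaths_def pathfinish_def pathstart_def)
    next
      case False
      then show ?thesis using that by (simp add: joinpaths_def)
    qed
  qed (use assms in \<open>auto simp: path_def path_image_def intro!: continuous_intros\<close>)
  ultimately show ?thesis by simp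
qed

text \<open>Turns a representative of -\<xi> into one of \<xi>, which supplies a witness for the
  choice operator in \<open>Cat\<close>.\<close>

definition neg_form :: "'a one_form \<Rightarrow> 'a one_form" where
  "neg_form \<omega> = \<lparr>cover = cover \<omega>, primitive = (\<lambda>U x. - primitive \<omega> U x)\<rparr>"

lemma closed_neg_form:
  assumes "closed_one_form X \<omega>"
  shows "closed_one_form X (neg_form \<omega>)"
proof -
  have "locally_constant_on W (\<lambda>x. - primitive \<omega> U x + primitive \<omega> V x)"
    if "locally_constant_on W (\<lambda>x. primitive \<omega> U x - primitive \<omega> V x)" for U V W
  proof -
    have *: "(\<lambda>x. - primitive \<omega> U x + primitive \<omega> V x) constant_on N"
      if "(\<lambda>x. primitive \<omega> U x - primitive \<omega> V x) constant_on N" for N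
      using that unfolding constant_on_def by (metis minus_diff_eq uminus_add_conv_diff)
    show ?thesis
      using that unfolding locally_constant_on_def by (blast intro: *)
  qed
  then show ?thesis
    using assms by (auto simp: closed_one_form_def neg_form_def intro: continuous_on_minus)
qed

lemma form_integral_neg_form:
  assumes "closed_one_form X \<omega>" "continuous_on {a..b} \<gamma>" "\<gamma> ` {a..b} \<subseteq> X" "a \<le> b"
  shows "form_integral (neg_form \<omega>) a b \<gamma> = - form_integral \<omega> a b \<gamma>"
proof -
  obtain F where F: "form_primitive \<omega> \<gamma> {a..b} F"
    using form_primitive_exists assms by metis
  have "- x - - y = - u - - v \<longleftrightarrow> x - y = u - v" for x y u v :: real by auto
  then have "form_primitive (neg_form \<omega>) \<gamma> {a..b} (\<lambda>s. - F s)"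
    using F by (simp only: form_primitive_def neg_form_def one_form.simps)
  then show ?thesis
    using form_integral_primitive[OF closed_neg_form[OF assms(1)] assms(2-4)]
      form_integral_primitive[OF assms F] by simp
qed

text \<open>Near each point of C a bound is found by bisecting the time interval; finitely many such
  neighbourhoods cover the compact set C. All partial integrals up to time t are controlled at
  once.\<close>

lemma form_integral_family_bounded:
  fixes \<Gamma> :: "'c::topological_space \<times> real \<Rightarrow> 'a::topological_space"
  assumes \<omega>: "closed_one_form X \<omega>" and \<Gamma>: "continuous_on (C \<times> {a..b}) \<Gamma>" "\<Gamma> ` (C \<times> {a..b}) \<subseteq> X"
    and "compact C" "a \<le> b"
  obtains B where "\<And>c t. c \<in> C \<Longrightarrow> t \<in> {a..b} \<Longrightarrow> \<bar>form_integral \<omega> a t (\<lambda>s. \<Gamma> (c, s))\<bar> \<le> B"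
proof -
  have cont: "continuous_on {u..v} (\<lambda>s. \<Gamma> (c, s))" and im: "(\<lambda>s. \<Gamma> (c, s)) ` {u..v} \<subseteq> X"
    if "c \<in> C" "a \<le> u" "v \<le> b" for c u v
    using that \<Gamma>(2)
    by (auto intro!: continuous_on_compose2[OF \<Gamma>(1)] continuous_intros)
  \<comment> \<open>All subintervals of [c, d] are included, so that an integral across the common
    end point of two adjacent intervals splits into two controlled pieces and the bounds add
    up.\<close>
  define P where "P N c d B \<longleftrightarrow> (\<forall>z\<in>C \<inter> N. \<forall>s t. c \<le> s \<and> s \<le> t \<and> t \<le> d \<longrightarrow>
      \<bar>form_integral \<omega> s t (\<lambda>s. \<Gamma> (z, s))\<bar> \<le> B)" for N c d B
  have "\<exists>N B. open N \<and> x \<in> N \<and> P N a b B" if x: "x \<in> C" for x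
  proof -
    have "a \<le> a \<and> b \<le> b \<longrightarrow> (\<exists>N B. open N \<and> x \<in> N \<and> P N a b B)"
    proof (rule Bolzano[where P = "\<lambda>c d. a \<le> c \<and> d \<le> b \<longrightarrow> (\<exists>N B. open N \<and> x \<in> N \<and> P N c d B)"])
      fix c d e :: real
      assume 1: "a \<le> c \<and> d \<le> b \<longrightarrow> (\<exists>N B. open N \<and> x \<in> N \<and> P N c d B)"
        "a \<le> d \<and> e \<le> b \<longrightarrow> (\<exists>N B. open N \<and> x \<in> N \<and> P N d e B)" "c \<le> d" "d \<le> e"
      show "a \<le> c \<and> e \<le> b \<longrightarrow> (\<exists>N B. open N \<and> x \<in> N \<and> P N c e B)"
      proof
        assume ce: "a \<le> c \<and> e \<le> b"
        obtain N B N' B' where N: "open N" "x \<in> N" "P N c d B" "open N'" "x \<in> N'" "P N' d e B'"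
          using 1 ce by (meson order_trans)
        \<comment> \<open>An interval of length 0 at the point x itself shows that both bounds are
          nonnegative.\<close>
        have B0: "0 \<le> B" "0 \<le> B'"
          using N x 1(3,4) unfolding P_def by (meson IntI abs_ge_zero order_refl order_trans)+
        have "P (N \<inter> N') c e (B + B')"
          unfolding P_def
        proof (intro ballI allI impI; elim conjE)
          fix z s t assume z: "z \<in> C \<inter> (N \<inter> N')" and st: "c \<le> s" "s \<le> t" "t \<le> e"
          let ?i = "\<lambda>s t. form_integral \<omega> s t (\<lambda>s. \<Gamma> (z, s))"
          consider "t \<le> d" | "d \<le> s" | "s \<le> d" "d \<le> t" by linarith
          then show "\<bar>?i s t\<bar> \<le> B + B'"
          proof cases
            case 1
            then have "\<bar>?i s t\<bar> \<le> B" using N z st unfolding P_def by blast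
            then show ?thesis using B0 by simp
          next
            case 2
            then have "\<bar>?i s t\<bar> \<le> B'" using N z st unfolding P_def by blast
            then show ?thesis using B0 by simp
          next
            case 3
            have "?i s t = ?i s d + ?i d t"
              using z ce st 3 by (intro form_integral_combine[OF \<omega>] cont im) auto
            moreover have "\<bar>?i s d\<bar> \<le> B" "\<bar>?i d t\<bar> \<le> B'"
              using N z st 3 unfolding P_def by blast+
            ultimately show ?thesis by simp
          qed
        qed
        then show "\<exists>N B. open N \<and> x \<in> N \<and> P N c e B" using N by (meson IntI open_Int)
      qed
    next
      fix y assume y: "a \<le> y" "y \<le> b"
      then have xy: "(x, y) \<in> C \<times> {a..b}" using x by auto
      then have "\<Gamma> (x, y) \<in> X" using \<Gamma> by auto
      with \<omega> obtain U where U: "U \<in> cover \<omega>" "\<Gamma> (x, y) \<in> U" "openin (top_of_set X) U"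
        by (rule closed_one_form_coverE)
      let ?f = "primitive \<omega> U"
      let ?D = "(C \<times> {a..b}) \<inter> \<Gamma> -` U"
      have D: "openin (top_of_set (C \<times> {a..b})) ?D"
        using \<Gamma> U by (simp add: continuous_on_open_gen image_subset_iff_funcset)
      have "continuous_on U ?f" using \<omega> U by (auto simp: closed_one_form_def)
      then have "continuous_on ?D (\<lambda>p. ?f (\<Gamma> p))"
        by (rule continuous_on_compose2) (auto intro: continuous_on_subset[OF \<Gamma>(1)])
      then have "openin (top_of_set ?D) (?D \<inter> (\<lambda>p. ?f (\<Gamma> p)) -` ball (?f (\<Gamma> (x, y))) 1)"
        by (simp add: continuous_openin_preimage_gen)
      then have "openin (top_of_set (C \<times> {a..b})) (?D \<inter> (\<lambda>p. ?f (\<Gamma> p)) -` ball (?f (\<Gamma> (x, y))) 1)"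
        using D openin_trans by blast
      then have "\<exists>T. open T \<and>
          ?D \<inter> (\<lambda>p. ?f (\<Gamma> p)) -` ball (?f (\<Gamma> (x, y))) 1 = (C \<times> {a..b}) \<inter> T"
        by (simp only: openin_open)
      then obtain T where T: "open T"
          "?D \<inter> (\<lambda>p. ?f (\<Gamma> p)) -` ball (?f (\<Gamma> (x, y))) 1 = (C \<times> {a..b}) \<inter> T"
        by (elim exE conjE) (rule that)
      have "(x, y) \<in> (C \<times> {a..b}) \<inter> T"
        unfolding T(2)[symmetric] using xy U(2) by simp
      then have "(x, y) \<in> T" by blast
      obtain N M where N: "open N" "open M" "x \<in> N" "y \<in> M" "N \<times> M \<subseteq> T"
        using open_prod_elim[OF T(1) \<open>(x, y) \<in> T\<close>] by (metis mem_Sigma_iff)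
      obtain d where d: "d > 0" "ball y d \<subseteq> M" using N open_contains_ball by blast
      show "\<exists>d>0. \<forall>c e. c \<le> y \<and> y \<le> e \<and> e - c < d \<longrightarrow>
        a \<le> c \<and> e \<le> b \<longrightarrow> (\<exists>N B. open N \<and> x \<in> N \<and> P N c e B)"
      proof (rule exI[of _ d], intro conjI d allI impI; elim conjE)
        fix c e assume ce: "c \<le> y" "y \<le> e" "e - c < d" "a \<le> c" "e \<le> b"
        have "{c..e} \<subseteq> ball y d" using ce by (auto simp: dist_real_def)
        then have sub: "{c..e} \<subseteq> M" using d by blast
        \<comment> \<open>On this box all values of the local primitive lie within 1 of its value at
          \<Gamma> (x, y), so increments are at most 2.\<close>
        have "P N c e 2"
          unfolding P_def
        proof (intro ballI allI impI; elim conjE)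
          fix z s t assume z: "z \<in> C \<inter> N" and st: "c \<le> s" "s \<le> t" "t \<le> e"
          have *: "\<Gamma> (z, r) \<in> U \<and> dist (?f (\<Gamma> (x, y))) (?f (\<Gamma> (z, r))) < 1" if "r \<in> {s..t}" for r
          proof -
            have "r \<in> {c..e}" using that st by auto
            then have "r \<in> M" using sub by blast
            then have "(z, r) \<in> T" using z N(5) by blast
            moreover have "r \<in> {a..b}" using \<open>r \<in> {c..e}\<close> ce by auto
            ultimately have "(z, r) \<in> C \<times> {a..b} \<inter> T" using z by blast
            then show ?thesis unfolding T(2)[symmetric] by simp
          qed
          have ct: "continuous_on {s..t} (\<lambda>s. \<Gamma> (z, s))" using cont z st ce by auto
          have "form_integral \<omega> s t (\<lambda>s. \<Gamma> (z, s)) = ?f (\<Gamma> (z, t)) - ?f (\<Gamma> (z, s))"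
            using * z st ce U
            by (intro form_integral_primitive[OF \<omega>] form_primitive_within_cover[OF \<omega>] ct im) auto
          then show "\<bar>form_integral \<omega> s t (\<lambda>s. \<Gamma> (z, s))\<bar> \<le> 2"
            using *[of s] *[of t] st by (auto simp: dist_real_def abs_if split: if_splits)
        qed
        then show "\<exists>N B. open N \<and> x \<in> N \<and> P N c e B" using N by blast
      qed
    qed (use assms in auto)
    then show ?thesis by simp
  qed
  then obtain N B where N: "\<And>x. x \<in> C \<Longrightarrow> open (N x) \<and> x \<in> N x \<and> P (N x) a b (B x)"
    by metis
  obtain D where D: "D \<subseteq> C" "finite D" "C \<subseteq> (\<Union>x\<in>D. N x)"
    using compactE_image[OF \<open>compact C\<close>, of C N] N by blast
  show ?thesis
  \<comment> \<open>A sum of absolute values is a common upper bound that also makes sense when C,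
    and with it D, is empty.\<close>
  proof (rule that[of "\<Sum>x\<in>D. \<bar>B x\<bar>"])
    fix c t assume c: "c \<in> C" and t: "t \<in> {a..b}"
    then obtain x where x: "x \<in> D" "c \<in> N x" using D by blast
    then have "\<bar>form_integral \<omega> a t (\<lambda>s. \<Gamma> (c, s))\<bar> \<le> B x"
      using N[of x] D c t unfolding P_def by auto
    also have "\<dots> \<le> \<bar>B x\<bar>" by simp
    also have "\<dots> \<le> (\<Sum>x\<in>D. \<bar>B x\<bar>)" using D x by (intro member_le_sum) auto
    finally show "\<bar>form_integral \<omega> a t (\<lambda>s. \<Gamma> (c, s))\<bar> \<le> (\<Sum>x\<in>D. \<bar>B x\<bar>)" .
  qed
qed

section \<open>Thickening open sets across cells\<close>

text \<open>Quantifying over all relatively open W, and not just W = A, makes the relation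
  transitive and lets it thicken unions of open top-dimensional cells as well as whole subcomplexes.
  The homotopy runs inside Y and may leave W'; only its end map is confined to W.\<close>

definition nbhd_extends :: "'a::topological_space set \<Rightarrow> 'a set \<Rightarrow> bool" where
  "nbhd_extends A Y \<longleftrightarrow> A \<subseteq> Y \<and>
     (\<forall>W. openin (top_of_set A) W \<longrightarrow>
        (\<exists>W' f. openin (top_of_set Y) W' \<and> W \<subseteq> W' \<and> f ` W' \<subseteq> W \<and>
           homotopic_with_canon (\<lambda>_. True) W' Y (\<lambda>x. x) f))"

lemma nbhd_extendsE:
  assumes "nbhd_extends A Y" "openin (top_of_set A) W"
  obtains W' f where "openin (top_of_set Y) W'" "W \<subseteq> W'" "f ` W' \<subseteq> W"
    "homotopic_with_canon (\<lambda>_. True) W' Y (\<lambda>x. x) f"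
  using assms unfolding nbhd_extends_def by meson

lemma nbhd_extends_refl: "nbhd_extends A A"
  unfolding nbhd_extends_def
proof (intro conjI allI impI)
  fix W assume W: "openin (top_of_set A) W"
  then have "homotopic_with_canon (\<lambda>_. True) W A (\<lambda>x. x) (\<lambda>x. x)"
    using openin_imp_subset[OF W] by (auto simp: continuous_map_in_subtopology)
  then show "\<exists>W' f. openin (top_of_set A) W' \<and> W \<subseteq> W' \<and> f ` W' \<subseteq> W \<and>
      homotopic_with_canon (\<lambda>_. True) W' A (\<lambda>x. x) f"
    using W by (intro exI[of _ W] exI[of _ "\<lambda>x. x"]) auto
qed simp

text \<open>The second thickening moves W'' into W' by g; the first homotopy, precomposed with g,
  then continues from g to f \<circ> g.\<close>

lemma nbhd_extends_trans:
  assumes "nbhd_extends A B" "nbhd_extends B C"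
  shows "nbhd_extends A C"
  unfolding nbhd_extends_def
proof (intro conjI allI impI)
  show "A \<subseteq> C" using assms by (auto simp: nbhd_extends_def)
  fix W assume "openin (top_of_set A) W"
  with assms(1) obtain W' f where f: "openin (top_of_set B) W'" "W \<subseteq> W'" "f ` W' \<subseteq> W"
    "homotopic_with_canon (\<lambda>_. True) W' B (\<lambda>x. x) f"
    by (rule nbhd_extendsE)
  from assms(2) f(1) obtain W'' g where g: "openin (top_of_set C) W''" "W' \<subseteq> W''" "g ` W'' \<subseteq> W'"
    "homotopic_with_canon (\<lambda>_. True) W'' C (\<lambda>x. x) g"
    by (rule nbhd_extendsE)
  have "B \<subseteq> C" using assms(2) by (simp add: nbhd_extends_def)
  then have "homotopic_with_canon (\<lambda>_. True) W' C (\<lambda>x. x) f"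
    using f(4) homotopic_with_subset_right by blast
  moreover have "continuous_on W'' g"
    using homotopic_with_imp_continuous_maps[OF g(4)] by (simp add: continuous_map_in_subtopology)
  ultimately have "homotopic_with_canon (\<lambda>_. True) W'' C ((\<lambda>x. x) \<circ> g) (f \<circ> g)"
    using g(3) by (intro homotopic_with_compose_continuous_right) auto
  then have "homotopic_with_canon (\<lambda>_. True) W'' C (\<lambda>x. x) (f \<circ> g)"
    using homotopic_with_trans[OF g(4)] by (simp add: o_def)
  moreover have "W \<subseteq> W''" "(f \<circ> g) ` W'' \<subseteq> W"
    using f(2,3) g(2,3) by (auto simp: image_subset_iff)
  ultimately show "\<exists>W' f. openin (top_of_set C) W' \<and> W \<subseteq> W' \<and> f ` W' \<subseteq> W \<and>
      homotopic_with_canon (\<lambda>_. True) W' C (\<lambda>x. x) f"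
    using g(1) by blast
qed

section \<open>Radial geometry of the standard disk\<close>

definition sqnorm :: "nat \<Rightarrow> (nat \<Rightarrow> real) \<Rightarrow> real" where
  "sqnorm d y = (\<Sum>i<d. (y i)\<^sup>2)"

definition scl :: "real \<Rightarrow> (nat \<Rightarrow> real) \<Rightarrow> nat \<Rightarrow> real" where
  "scl c y = (\<lambda>i. c * y i)"

lemma scl_1 [simp]: "scl 1 y = y"
  by (simp add: scl_def)

lemma sqnorm_scl: "sqnorm d (scl c y) = c\<^sup>2 * sqnorm d y"
  by (simp add: sqnorm_def scl_def power_mult_distrib sum_distrib_left)

lemma sqnorm_nonneg: "0 \<le> sqnorm d y"
  by (simp add: sqnorm_def sum_nonneg)

lemma cdisk_iff: "y \<in> cdisk d \<longleftrightarrow> (\<forall>i\<ge>d. y i = 0) \<and> sqnorm d y \<le> 1"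
  and odisk_iff: "y \<in> odisk d \<longleftrightarrow> (\<forall>i\<ge>d. y i = 0) \<and> sqnorm d y < 1"
  and bsphere_iff: "y \<in> bsphere d \<longleftrightarrow> (\<forall>i\<ge>d. y i = 0) \<and> sqnorm d y = 1"
  by (auto simp: cdisk_def odisk_def bsphere_def sqnorm_def topspace_Euclidean_space)

lemma cdisk_eq: "cdisk d = odisk d \<union> bsphere d"
  by (auto simp: cdisk_iff odisk_iff bsphere_iff)

lemma scl_in_cdisk:
  assumes "y \<in> cdisk d" "0 \<le> c" "c \<le> 1"
  shows "scl c y \<in> cdisk d"
proof -
  have "c\<^sup>2 * sqnorm d y \<le> 1 * 1"
    using assms sqnorm_nonneg[of d y] by (intro mult_mono power_le_one) (auto simp: cdisk_iff)
  then show ?thesis using assms by (auto simp: cdisk_iff sqnorm_scl) (simp add: scl_def)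
qed

lemma scl_in_odisk:
  assumes "y \<in> odisk d" "0 \<le> c" "c \<le> 1"
  shows "scl c y \<in> odisk d"
proof -
  have "c\<^sup>2 * sqnorm d y \<le> 1 * sqnorm d y"
    using assms sqnorm_nonneg[of d y] by (intro mult_right_mono power_le_one) auto
  then have "c\<^sup>2 * sqnorm d y < 1" using assms by (simp add: odisk_iff)
  then show ?thesis using assms by (auto simp: odisk_iff sqnorm_scl) (simp add: scl_def)
qed

lemma continuous_on_sqnorm [continuous_intros]:
  "continuous_on S f \<Longrightarrow> continuous_on S (\<lambda>x. sqnorm d (f x))"
  unfolding sqnorm_def
  by (intro continuous_on_sum continuous_on_power) (rule continuous_on_product_then_coordinatewise)

lemma continuous_on_scl:
  "continuous_on S c \<Longrightarrow> continuous_on S f \<Longrightarrow> continuous_on S (\<lambda>x. scl (c x) (f x))"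
  unfolding scl_def
  by (rule continuous_on_coordinatewise_then_product, rule continuous_on_mult, assumption)
    (rule continuous_on_product_then_coordinatewise)

text \<open>The disk sits in an infinite product of lines, where it is a closed subset of the
  Tychonoff cube with factors [-1, 1].\<close>

lemma compact_cdisk: "compact (cdisk d)"
proof -
  have "compactin (product_topology (\<lambda>i::nat. euclideanreal) UNIV) (PiE UNIV (\<lambda>i. {-1..1}))"
    by (simp add: compactin_PiE)
  then have "compact (PiE UNIV (\<lambda>i. {-1..1}) :: (nat \<Rightarrow> real) set)"
    by (simp add: euclidean_product_topology)
  moreover have "closed (cdisk d)"
  proof -
    have "cdisk d = (\<Inter>i\<in>{d..}. {y. y i \<le> 0} \<inter> {y. 0 \<le> y i}) \<inter> {y. sqnorm d y \<le> 1}"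
      by (auto simp: cdisk_iff order_eq_iff[of _ "0::real"])
    moreover have "closed {y. y i \<le> (0::real)}" "closed {y. (0::real) \<le> y i}" for i :: nat
      by (rule closed_Collect_le; simp)+
    moreover have "closed {y. sqnorm d y \<le> 1}"
      by (intro closed_Collect_le continuous_intros)
    ultimately show ?thesis by (simp add: closed_INT closed_Int)
  qed
  ultimately have "compact (PiE UNIV (\<lambda>i. {-1..1}) \<inter> cdisk d)"
    by (rule compact_Int_closed)
  moreover have "cdisk d \<subseteq> PiE UNIV (\<lambda>i. {-1..1})"
  proof
    fix y assume y: "y \<in> cdisk d"
    have "\<bar>y i\<bar> \<le> 1" for i
    proof (cases "i < d")
      case True
      then have "(y i)\<^sup>2 \<le> sqnorm d y"
        unfolding sqnorm_def by (intro member_le_sum) auto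
      then show ?thesis using y by (simp add: cdisk_iff flip: abs_square_le_1)
    next
      case False
      then show ?thesis using y by (simp add: cdisk_iff)
    qed
    then show "y \<in> PiE UNIV (\<lambda>i. {-1..1})" by (auto simp: PiE_UNIV_domain abs_le_iff minus_le_iff)
  qed
  ultimately show ?thesis by (simp add: Int_absorb1)
qed

lemma compact_imp_closedin_Hausdorff:
  assumes "Hausdorff_space (top_of_set Y)" "compact S" "S \<subseteq> Y"
  shows "closedin (top_of_set Y) S"
  using assms by (intro compactin_imp_closedin) (auto simp: compactin_subtopology)

text \<open>A point of the cell other than its centre is pushed radially to the boundary, so \<open>W\<close> is enlarged
  by the cone over its preimage with the apex removed.\<close>

lemma nbhd_extends_attach_cell:
  assumes haus: "Hausdorff_space (top_of_set Y)" and A: "closedin (top_of_set Y) A"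
    and cont: "continuous_on (cdisk d) \<Phi>" and Y: "Y = A \<union> \<Phi> ` odisk d"
    and bd: "\<Phi> ` bsphere d \<subseteq> A" and inj: "inj_on \<Phi> (odisk d)" and disj: "\<Phi> ` odisk d \<inter> A = {}"
  shows "nbhd_extends A Y"
  unfolding nbhd_extends_def
proof (intro conjI allI impI)
  show "A \<subseteq> Y" using Y by simp
  fix W assume W: "openin (top_of_set A) W"
  then have WA: "W \<subseteq> A" by (rule openin_imp_subset)
  have \<Phi>Y: "\<Phi> ` cdisk d \<subseteq> Y" using Y bd by (auto simp: cdisk_eq)
  define \<rho> where "\<rho> y = scl (1 / sqrt (sqnorm d y)) y" for y
  define P where "P = {y \<in> cdisk d. sqnorm d y > 0}"
  define O' where "O' = {y \<in> P. \<Phi> (\<rho> y) \<in> W}"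
  define W' where "W' = W \<union> \<Phi> ` O'"
  have O'P: "O' \<subseteq> P" and PD: "P \<subseteq> cdisk d" by (auto simp: O'_def P_def)
  have \<rho>_sphere: "\<rho> y \<in> bsphere d" if "y \<in> P" for y
    using that by (auto simp: \<rho>_def P_def bsphere_iff sqnorm_scl cdisk_iff power_divide)
      (simp add: scl_def)
  have \<rho>_id: "\<rho> y = y" if "y \<in> bsphere d" for y
    using that by (simp add: \<rho>_def bsphere_iff)
  have sphere_P: "bsphere d \<subseteq> P"
    by (auto simp: P_def bsphere_iff cdisk_iff)
  \<comment> \<open>Saturation: \<open>O'\<close> is the full preimage of W' in the closed disk. For
    interior points this rests on injectivity of \<Phi>, for boundary points on \<rho> fixing the
    sphere. Both the openness of W' and the continuity of the deformation depend on it.\<close>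
  have in_O': "y \<in> O'" if "y \<in> cdisk d" "\<Phi> y \<in> W'" for y
  proof (cases "y \<in> odisk d")
    case True
    then have "\<Phi> y \<notin> A" using disj by blast
    then have "\<Phi> y \<in> \<Phi> ` O'" using that WA W'_def by blast
    then obtain z where z: "z \<in> O'" "\<Phi> y = \<Phi> z" by blast
    have "z \<notin> bsphere d" using \<open>\<Phi> y \<notin> A\<close> z bd by auto
    then have "z \<in> odisk d" using z O'P PD by (auto simp: cdisk_eq)
    then show ?thesis using inj z True by (auto dest: inj_onD)
  next
    case False
    then have y: "y \<in> bsphere d" using that by (auto simp: cdisk_eq)
    have "\<Phi> y \<in> W"
    proof (cases "\<Phi> y \<in> W")
      case False
      then have "\<Phi> y \<in> \<Phi> ` O'" using that W'_def by blast
      then obtain z where z: "z \<in> O'" "\<Phi> y = \<Phi> z" by blast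
      have "\<Phi> z \<in> A" using z y bd by auto
      then have "z \<notin> odisk d" using disj by auto
      then have "z \<in> bsphere d" using z O'P PD by (auto simp: cdisk_eq)
      then show ?thesis using z \<rho>_id by (auto simp: O'_def)
    qed
    then show ?thesis using y \<rho>_id sphere_P by (auto simp: O'_def)
  qed
  have "openin (top_of_set (cdisk d)) O'"
  proof -
    have "continuous_on P \<rho>"
      unfolding \<rho>_def by (rule continuous_on_scl) (intro continuous_intros; auto simp: P_def)+
    moreover have "continuous_on (\<rho> ` P) \<Phi>"
      using \<rho>_sphere by (intro continuous_on_subset[OF cont]) (auto simp: cdisk_eq)
    ultimately have c: "continuous_on P (\<lambda>y. \<Phi> (\<rho> y))"
      using continuous_on_compose by (fastforce simp: o_def)
    moreover have "(\<lambda>y. \<Phi> (\<rho> y)) \<in> P \<rightarrow> A"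
      using \<rho>_sphere bd by auto
    ultimately have "openin (top_of_set P) (P \<inter> (\<lambda>y. \<Phi> (\<rho> y)) -` W)"
      using W by (rule continuous_openin_preimage)
    moreover have "P \<inter> (\<lambda>y. \<Phi> (\<rho> y)) -` W = O'" by (auto simp: O'_def)
    moreover have "openin (top_of_set (cdisk d)) P"
    proof -
      have "P = cdisk d \<inter> sqnorm d -` {0<..}" by (auto simp: P_def)
      then show ?thesis
        using continuous_openin_preimage_gen[of "cdisk d" "sqnorm d" "{0<..}"]
          continuous_on_sqnorm[of "cdisk d" "\<lambda>x. x"] by simp
    qed
    ultimately show ?thesis using openin_trans by metis
  qed
  \<comment> \<open>Openness of W' is proved through its complement, the union of A - W and the
    image of the compact set \<open>cdisk d - O'\<close>.\<close>
  then have "closedin (top_of_set (cdisk d)) (cdisk d - O')"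
    by (intro closedin_diff) auto
  then have "compact (cdisk d - O')"
    using compact_cdisk closedin_compact by blast
  then have "compact (\<Phi> ` (cdisk d - O'))"
    by (rule compact_continuous_image[rotated]) (auto intro: continuous_on_subset[OF cont])
  then have "closedin (top_of_set Y) (\<Phi> ` (cdisk d - O'))"
    using haus \<Phi>Y by (intro compact_imp_closedin_Hausdorff) auto
  moreover have "closedin (top_of_set Y) (A - W)"
    by (rule closedin_trans[OF closedin_diff[OF _ W] A]) simp
  ultimately have "closedin (top_of_set Y) ((A - W) \<union> \<Phi> ` (cdisk d - O'))"
    by (rule closedin_Un[rotated])
  moreover have "Y - W' = (A - W) \<union> \<Phi> ` (cdisk d - O')"
  proof (intro equalityI subsetI)
    fix x assume x: "x \<in> Y - W'"
    then show "x \<in> (A - W) \<union> \<Phi> ` (cdisk d - O')"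
      unfolding Y W'_def by (auto simp: cdisk_eq)
  next
    fix x assume x: "x \<in> (A - W) \<union> \<Phi> ` (cdisk d - O')"
    then show "x \<in> Y - W'"
    proof
      assume xA: "x \<in> A - W"
      have "x \<notin> \<Phi> ` O'"
      proof
        assume "x \<in> \<Phi> ` O'"
        then obtain y where y: "y \<in> O'" "x = \<Phi> y" by blast
        then have "y \<notin> odisk d" using xA disj by auto
        then have "y \<in> bsphere d" using y O'P PD by (auto simp: cdisk_eq)
        then show False using y xA \<rho>_id by (auto simp: O'_def)
      qed
      then show ?thesis using xA Y by (auto simp: W'_def)
    next
      assume "x \<in> \<Phi> ` (cdisk d - O')"
      then show ?thesis using in_O' \<Phi>Y by auto
    qed
  qed
  moreover have W'Y: "W' \<subseteq> Y"
  proof -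
    have "\<Phi> ` O' \<subseteq> Y" using \<Phi>Y O'P PD by blast
    then show ?thesis using WA Y by (auto simp: W'_def)
  qed
  ultimately have openW': "openin (top_of_set Y) W'"
    by (simp add: openin_closedin_eq)
  \<comment> \<open>Under G a point of radius r has radius (1 - t) * r + t at time t, so it stays in
    the disk and reaches \<rho> y at time 1.\<close>
  define G where "G t y = scl ((1 - t) + t / sqrt (sqnorm d y)) y" for t y
  define h where "h = (\<lambda>(t, x). if x \<in> A then x else \<Phi> (G t (inv_into (odisk d) \<Phi> x)))"
  have h_A: "h (t, x) = x" if "x \<in> A" for t x using that by (simp add: h_def)
  have G_0: "G 0 y = y" and G_1: "G 1 y = \<rho> y" for y by (simp_all add: G_def \<rho>_def)
  have G_sphere: "G t y = y" if "y \<in> bsphere d" for t y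
    using that by (simp add: G_def bsphere_iff)
  have h_\<Phi>: "h (t, \<Phi> y) = \<Phi> (G t y)" if "y \<in> cdisk d" for t y
  proof (cases "y \<in> odisk d")
    case True
    then have "\<Phi> y \<notin> A" using disj by blast
    then show ?thesis using inj True by (simp add: h_def)
  next
    case False
    then have "y \<in> bsphere d" using that by (auto simp: cdisk_eq)
    then show ?thesis using bd G_sphere h_A by auto
  qed
  have G_disk: "G t y \<in> cdisk d" if "y \<in> P" "t \<in> {0..1}" for t y
  proof -
    let ?N = "sqrt (sqnorm d y)"
    have N: "0 < ?N" "?N \<le> 1" using that by (auto simp: P_def cdisk_iff)
    have "sqnorm d (G t y) = (((1 - t) + t / ?N) * ?N)\<^sup>2"
      using N by (simp add: G_def sqnorm_scl power_mult_distrib)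
    also have "((1 - t) + t / ?N) * ?N = (1 - t) * ?N + t"
      using N by (simp add: field_simps)
    also have "((1 - t) * ?N + t)\<^sup>2 \<le> 1"
    proof (rule power_le_one)
      show "0 \<le> (1 - t) * ?N + t" using that N by simp
      have "(1 - t) * ?N \<le> (1 - t) * 1" using that N by (intro mult_left_mono) auto
      then show "(1 - t) * ?N + t \<le> 1" by simp
    qed
    finally show ?thesis using that by (auto simp: cdisk_iff P_def) (simp add: G_def scl_def)
  qed
  have contG: "continuous_on ({0..1} \<times> P) (\<lambda>(t, y). \<Phi> (G t y))"
  proof -
    have "continuous_on ({0..1} \<times> P) (\<lambda>p. G (fst p) (snd p))"
      unfolding G_def by (rule continuous_on_scl) (intro continuous_intros; auto simp: P_def)+
    then have "continuous_on ({0..1} \<times> P) (\<lambda>p. \<Phi> (G (fst p) (snd p)))"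
      by (rule continuous_on_compose2[OF cont]) (use G_disk in auto)
    then show ?thesis by (simp add: case_prod_beta)
  qed
  let ?I = "{0..1} :: real set"
  let ?CC = "\<Phi> ` O'"
  have closedin_W': "closedin (top_of_set W') (W' \<inter> S)" if "closedin (top_of_set Y) S" for S
    using closedin_subtopology_Int_closed[OF that, of W'] W'Y
    by (simp add: subtopology_subtopology Int_absorb1)
  have "closedin (top_of_set Y) (\<Phi> ` cdisk d)"
    using haus \<Phi>Y compact_cdisk cont
    by (intro compact_imp_closedin_Hausdorff compact_continuous_image)
  moreover have "?CC = W' \<inter> \<Phi> ` cdisk d"
  proof
    show "?CC \<subseteq> W' \<inter> \<Phi> ` cdisk d" using O'P PD by (auto simp: W'_def)
    show "W' \<inter> \<Phi> ` cdisk d \<subseteq> ?CC" using in_O' by blast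
  qed
  ultimately have closCC: "closedin (top_of_set W') ?CC"
    using closedin_W' by metis
  have "W = W' \<inter> A"
  proof -
    have "y \<in> W" if "y \<in> A" "y = \<Phi> z" "z \<in> O'" for y z
    proof -
      have "z \<notin> odisk d" using that disj by auto
      then have "z \<in> bsphere d" using that O'P PD by (auto simp: cdisk_eq)
      then show ?thesis using that \<rho>_id by (auto simp: O'_def)
    qed
    then show ?thesis using WA by (auto simp: W'_def)
  qed
  then have closW: "closedin (top_of_set W') W"
    using closedin_W'[OF A] by simp
  have "continuous_on (?I \<times> W) h"
    by (rule continuous_on_eq[OF continuous_on_snd[OF continuous_on_id]]) (use WA h_A in auto)
  moreover have "continuous_on (?I \<times> ?CC) h"
  proof -
    \<comment> \<open>On this part h is known through \<Phi>, so its continuity is tested on {0..1}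
      \<times> O'. The map (t, y) to (t, \<Phi> y) is closed on the compact product with the whole
      disk; restricted to the saturated set {0..1} \<times> O' it remains closed and is therefore a
      quotient map.\<close>
    let ?q = "\<lambda>(t, y). (t, \<Phi> y)"
    have "closed_map (top_of_set (?I \<times> cdisk d)) (top_of_set (?I \<times> Y)) ?q"
    proof (rule continuous_imp_closed_map)
      have "continuous_on (?I \<times> cdisk d) (\<lambda>p. (fst p, \<Phi> (snd p)))"
        by (intro continuous_intros continuous_on_compose2[OF cont]) auto
      then have "continuous_on (?I \<times> cdisk d) ?q" by (simp add: case_prod_beta)
      then show "continuous_map (top_of_set (?I \<times> cdisk d)) (top_of_set (?I \<times> Y)) ?q"
        using \<Phi>Y by (auto simp: continuous_map_in_subtopology)
      show "compact_space (top_of_set (?I \<times> cdisk d))"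
        by (intro compact_space_subtopology) (simp add: compact_Times compact_cdisk)
      have "Hausdorff_space (prod_topology (top_of_set ?I) (top_of_set Y))"
        using haus by (simp add: Hausdorff_space_prod_topology Hausdorff_space_subtopology
            del: prod_topology_subtopology_eu)
      then show "Hausdorff_space (top_of_set (?I \<times> Y))" by simp
    qed
    moreover have "{p \<in> topspace (top_of_set (?I \<times> cdisk d)). ?q p \<in> ?I \<times> ?CC} = ?I \<times> O'"
      using in_O' O'P PD by (auto simp: W'_def)
    ultimately have "closed_map (subtopology (top_of_set (?I \<times> cdisk d)) (?I \<times> O'))
        (subtopology (top_of_set (?I \<times> Y)) (?I \<times> ?CC)) ?q"
      by (rule closed_map_restriction)
    moreover have "(?I \<times> cdisk d) \<inter> (?I \<times> O') = ?I \<times> O'" "(?I \<times> Y) \<inter> (?I \<times> ?CC) = ?I \<times> ?CC"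
      using O'P PD \<Phi>Y by auto
    ultimately have "closed_map (top_of_set (?I \<times> O')) (top_of_set (?I \<times> ?CC)) ?q"
      by (simp add: subtopology_subtopology)
    moreover have "continuous_on (?I \<times> O') (\<lambda>p. (fst p, \<Phi> (snd p)))"
      by (intro continuous_intros continuous_on_compose2[OF cont]) (use O'P PD in auto)
    then have "continuous_map (top_of_set (?I \<times> O')) (top_of_set (?I \<times> ?CC)) ?q"
      by (auto simp: continuous_map_in_subtopology case_prod_beta)
    moreover have "?q ` (?I \<times> O') = ?I \<times> ?CC" by force
    ultimately have "quotient_map (top_of_set (?I \<times> O')) (top_of_set (?I \<times> ?CC)) ?q"
      by (intro continuous_closed_imp_quotient_map) auto
    moreover have "continuous_on (?I \<times> O') (\<lambda>(t, y). \<Phi> (G t y))"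
      using O'P by (intro continuous_on_subset[OF contG]) auto
    then have "continuous_on (?I \<times> O') (h \<circ> ?q)"
      by (rule continuous_on_eq) (use h_\<Phi> O'P PD in auto)
    then have "continuous_map (top_of_set (?I \<times> O')) euclidean (h \<circ> ?q)" by simp
    ultimately have "continuous_map (top_of_set (?I \<times> ?CC)) euclidean h"
      by (rule continuous_compose_quotient_map)
    then show ?thesis by simp
  qed
  moreover have "closedin (top_of_set (?I \<times> W')) (?I \<times> W)" "closedin (top_of_set (?I \<times> W')) (?I \<times> ?CC)"
    using closCC closW by (auto intro!: closedin_Times)
  moreover have "?I \<times> W' = (?I \<times> W) \<union> (?I \<times> ?CC)" by (auto simp: W'_def)
  ultimately have conth: "continuous_on (?I \<times> W') h"
    using continuous_on_Un_local[of "?I \<times> W" "?I \<times> ?CC" h] by simp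
  have hY: "h ` (?I \<times> W') \<subseteq> Y"
  proof clarify
    fix t x assume t: "t \<in> ?I" and x: "x \<in> W'"
    show "h (t, x) \<in> Y"
    proof (cases "x \<in> W")
      case True then show ?thesis using WA Y h_A by auto
    next
      case False
      then obtain y where y: "y \<in> O'" "x = \<Phi> y" using x by (auto simp: W'_def)
      then have "y \<in> P" "y \<in> cdisk d" using O'P PD by auto
      then show ?thesis using h_\<Phi>[of y t] G_disk[of y t] y t \<Phi>Y by auto
    qed
  qed
  have "homotopic_with_canon (\<lambda>_. True) W' Y (\<lambda>x. x) (\<lambda>x. h (1, x))"
  proof -
    have "h (0, x) = x" if x: "x \<in> W'" for x
    proof (cases "x \<in> W")
      case True then show ?thesis using WA h_A by auto
    next
      case False
      then obtain y where y: "y \<in> O'" "x = \<Phi> y" using x by (auto simp: W'_def)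
      then show ?thesis using h_\<Phi>[of y 0] O'P PD G_0 by auto
    qed
    moreover have "continuous_map (top_of_set (?I \<times> W')) (top_of_set Y) h"
      using conth hY by (auto simp: continuous_map_in_subtopology)
    ultimately show ?thesis
      by (subst homotopic_with) (auto intro!: exI[of _ h])
  qed
  moreover have "(\<lambda>x. h (1, x)) ` W' \<subseteq> W"
  proof clarify
    fix x assume x: "x \<in> W'"
    show "h (1, x) \<in> W"
    proof (cases "x \<in> W")
      case True then show ?thesis using WA h_A by auto
    next
      case False
      then obtain y where y: "y \<in> O'" "x = \<Phi> y" using x by (auto simp: W'_def)
      then show ?thesis using h_\<Phi>[of y 1] O'P PD G_1 by (auto simp: O'_def)
    qed
  qed
  moreover have "W \<subseteq> W'" by (auto simp: W'_def)
  ultimately show "\<exists>W' f. openin (top_of_set Y) W' \<and> W \<subseteq> W' \<and> f ` W' \<subseteq> W \<and>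
      homotopic_with_canon (\<lambda>_. True) W' Y (\<lambda>x. x) f"
    using openW' by blast
qed

text \<open>Homotopies on disjoint relatively open pieces are compatible for trivial reasons, so the
  pasting lemma joins them. The end map g is common to all pieces, which is why the cells are later
  contracted to one common point.\<close>

lemma homotopic_with_canon_disjoint_opens:
  assumes ope: "\<And>i. i \<in> I \<Longrightarrow> openin (top_of_set (\<Union>i\<in>I. S i)) (S i)"
    and disj: "disjoint_family_on S I"
    and hom: "\<And>i. i \<in> I \<Longrightarrow> homotopic_with_canon (\<lambda>_. True) (S i) Y f g"
  shows "homotopic_with_canon (\<lambda>_. True) (\<Union>i\<in>I. S i) Y f g"
proof -
  let ?J = "{0..1} :: real set" and ?S = "\<Union>i\<in>I. S i"
  have "\<exists>h. continuous_map (top_of_set (?J \<times> S i)) (top_of_set Y) h \<and>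
      (\<forall>x. h (0, x) = f x) \<and> (\<forall>x. h (1, x) = g x)" if "i \<in> I" for i
    using hom[OF that] unfolding homotopic_with_def by auto
  then obtain h where h: "\<And>i. i \<in> I \<Longrightarrow> continuous_map (top_of_set (?J \<times> S i)) (top_of_set Y) (h i)"
    "\<And>i x. i \<in> I \<Longrightarrow> h i (0, x) = f x" "\<And>i x. i \<in> I \<Longrightarrow> h i (1, x) = g x"
    by metis
  have S: "(?J \<times> ?S) \<inter> (?J \<times> S i) = ?J \<times> S i" if "i \<in> I" for i using that by auto
  obtain k where k: "continuous_map (top_of_set (?J \<times> ?S)) (top_of_set Y) k"
    "\<And>x i. i \<in> I \<Longrightarrow> x \<in> topspace (top_of_set (?J \<times> ?S)) \<inter> (?J \<times> S i) \<Longrightarrow> k x = h i x"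
  proof (rule pasting_lemma_exists[where I = I and X = "top_of_set (?J \<times> ?S)"
        and T = "\<lambda>i. ?J \<times> S i" and f = h and Y = "top_of_set Y"])
    show "topspace (top_of_set (?J \<times> ?S)) \<subseteq> (\<Union>i\<in>I. ?J \<times> S i)" by auto
    show "openin (top_of_set (?J \<times> ?S)) (?J \<times> S i)" if "i \<in> I" for i
      using ope[OF that] by (intro openin_Times) auto
    show "continuous_map (subtopology (top_of_set (?J \<times> ?S)) (?J \<times> S i)) (top_of_set Y) (h i)"
      if "i \<in> I" for i
      using h(1)[OF that] S[OF that] by (simp add: subtopology_subtopology)
    show "h i x = h j x" if "i \<in> I" "j \<in> I"
      "x \<in> topspace (top_of_set (?J \<times> ?S)) \<inter> (?J \<times> S i) \<inter> (?J \<times> S j)" for i j x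
    proof -
      have "S i \<inter> S j \<noteq> {}" using that by auto
      then have "i = j" using disj that unfolding disjoint_family_on_def by blast
      then show ?thesis by simp
    qed
  qed (use that in blast)
  have "k (t, x) = h i (t, x)" if "i \<in> I" "x \<in> S i" "t \<in> ?J" for i x t
    using k(2)[of i "(t, x)"] that by auto
  then have "k (0, x) = f x" "k (1, x) = g x" if "x \<in> ?S" for x
    using h(2,3) that by auto
  then show ?thesis
  proof (subst homotopic_with)
    show "\<exists>h. continuous_map (prod_topology (top_of_set ?J) (top_of_set ?S)) (top_of_set Y) h \<and>
        (\<forall>x\<in>topspace (top_of_set ?S). h (0, x) = f x) \<and>
        (\<forall>x\<in>topspace (top_of_set ?S). h (1, x) = g x) \<and> (\<forall>t\<in>?J. True)"
      if "\<And>x. x \<in> ?S \<Longrightarrow> k (0, x) = f x" "\<And>x. x \<in> ?S \<Longrightarrow> k (1, x) = g x"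
      using k(1) that by (intro exI[of _ k]) simp
  qed simp
qed

section \<open>Finite CW complexes\<close>

locale finite_cw =
  fixes X :: "'a::topological_space set" and K :: "('a, 'e) cell_structure"
  assumes finite_cw: "finite_cw_complex X K"
begin

text \<open>Any set of cells is allowed, so that differences of subcomplexes, such as the open cells
  of one dimension, are covered too.\<close>

definition subc :: "'e set \<Rightarrow> 'a set" where
  "subc F = (\<Union>e\<in>F. open_cell K e)"

text \<open>Stronger than being a subcomplex: F consists of all cells below some dimension together
  with some cells of that dimension. This is stated without incidences between cells and still
  ensures that F contains the boundaries of its cells.\<close>

definition lower_closed :: "'e set \<Rightarrow> bool" where
  "lower_closed F \<longleftrightarrow> F \<subseteq> cells K \<and>
     (\<forall>e\<in>F. \<forall>e'\<in>cells K. cell_dim K e' < cell_dim K e \<longrightarrow> e' \<in> F)"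

lemma finite_cells: "finite (cells K)"
  and Hausdorff: "Hausdorff_space (top_of_set X)"
  and X_eq: "X = subc (cells K)"
  and disjoint_cells: "disjoint_family_on (open_cell K) (cells K)"
  using finite_cw unfolding finite_cw_complex_def cw_complex_def subc_def by - (elim conjE; assumption)+

lemma char_maps: "\<forall>e\<in>cells K. continuous_on (cdisk (cell_dim K e)) (char_map K e) \<and>
        closed_cell K e \<subseteq> X \<and>
        (\<exists>g. homeomorphism (odisk (cell_dim K e)) (open_cell K e) (char_map K e) g)"
  and boundaries: "\<forall>e\<in>cells K. \<exists>F. finite F \<and> F \<subseteq> {e'\<in>cells K. cell_dim K e' < cell_dim K e} \<and>
        char_map K e ` bsphere (cell_dim K e) \<subseteq> (\<Union>e'\<in>F. open_cell K e')"
  using finite_cw unfolding finite_cw_complex_def cw_complex_def by - (elim conjE; assumption)+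

lemma
  assumes "e \<in> cells K"
  shows continuous_char_map: "continuous_on (cdisk (cell_dim K e)) (char_map K e)"
    and closed_cell_subset: "closed_cell K e \<subseteq> X"
    and open_cell_homeomorphism:
      "\<exists>g. homeomorphism (odisk (cell_dim K e)) (open_cell K e) (char_map K e) g"
    and cell_boundary: "\<exists>F. finite F \<and> F \<subseteq> {e'\<in>cells K. cell_dim K e' < cell_dim K e} \<and>
        char_map K e ` bsphere (cell_dim K e) \<subseteq> (\<Union>e'\<in>F. open_cell K e')"
  using char_maps boundaries assms by simp_all

lemma inj_on_char_map:
  assumes "e \<in> cells K"
  shows "inj_on (char_map K e) (odisk (cell_dim K e))"
  using open_cell_homeomorphism[OF assms] by (auto simp: homeomorphism_def intro: inj_on_inverseI)

lemma closed_cell_eq: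
  "closed_cell K e = open_cell K e \<union> char_map K e ` bsphere (cell_dim K e)"
  by (simp add: closed_cell_def open_cell_def cdisk_eq image_Un)

lemma boundary_subset_subc:
  assumes "e \<in> cells K" "{e'\<in>cells K. cell_dim K e' < cell_dim K e} \<subseteq> F"
  shows "char_map K e ` bsphere (cell_dim K e) \<subseteq> subc F"
  using cell_boundary[OF assms(1)] assms(2) unfolding subc_def by blast

section \<open>Topology of unions of cells\<close>

lemma subc_mono: "F \<subseteq> G \<Longrightarrow> subc F \<subseteq> subc G"
  by (auto simp: subc_def)

lemma subc_subset: "F \<subseteq> cells K \<Longrightarrow> subc F \<subseteq> X"
  using subc_mono X_eq by blast

lemma subc_Diff:
  assumes "F \<subseteq> cells K" "G \<subseteq> cells K"
  shows "subc F - subc G = subc (F - G)"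
proof -
  have "e = e'" if "e \<in> F" "e' \<in> G" "x \<in> open_cell K e" "x \<in> open_cell K e'" for x e e'
    using that assms disjoint_cells unfolding disjoint_family_on_def by blast
  then show ?thesis by (fastforce simp: subc_def)
qed

lemma compact_closed_cell: "e \<in> cells K \<Longrightarrow> compact (closed_cell K e)"
  unfolding closed_cell_def by (intro compact_continuous_image continuous_char_map compact_cdisk)

text \<open>Adding the boundaries changes nothing, since they lie in cells of smaller dimension,
  which belong to F. The result is a finite union of compact sets.\<close>

lemma subc_eq_closed_cells:
  assumes "lower_closed F"
  shows "subc F = (\<Union>e\<in>F. closed_cell K e)"
proof -
  have "char_map K e ` bsphere (cell_dim K e) \<subseteq> subc F" if "e \<in> F" for e
    using that assms unfolding lower_closed_def by (intro boundary_subset_subc) auto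
  then show ?thesis unfolding closed_cell_eq by (auto simp: subc_def)
qed

lemma compact_subc:
  assumes "lower_closed F"
  shows "compact (subc F)"
proof -
  have "finite F" "F \<subseteq> cells K"
    using assms finite_cells finite_subset unfolding lower_closed_def by auto
  then show ?thesis
    unfolding subc_eq_closed_cells[OF assms] using compact_closed_cell by (intro compact_UN) auto
qed

lemma lower_closed_cells: "lower_closed (cells K)"
  by (auto simp: lower_closed_def)

lemma compact_X: "compact X"
  using compact_subc[OF lower_closed_cells] by (simp flip: X_eq)

lemma closedin_subc:
  assumes "lower_closed F" "F \<subseteq> G" "G \<subseteq> cells K"
  shows "closedin (top_of_set (subc G)) (subc F)"
  using assms
  by (intro compact_imp_closedin_Hausdorff compact_subc subc_mono)
    (metis Hausdorff Hausdorff_space_subtopology subc_subset subtopology_subtopology inf.absorb2)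

lemma nbhd_extends_insert_cell:
  assumes "lower_closed F" "lower_closed (insert e F)" "e \<notin> F"
  shows "nbhd_extends (subc F) (subc (insert e F))"
proof -
  have e: "e \<in> cells K" and F: "F \<subseteq> cells K" using assms by (auto simp: lower_closed_def)
  show ?thesis
  proof (rule nbhd_extends_attach_cell)
    show "Hausdorff_space (top_of_set (subc (insert e F)))"
      using e F by (metis Hausdorff Hausdorff_space_subtopology insert_subset subc_subset
          subtopology_subtopology inf.absorb2)
    show "closedin (top_of_set (subc (insert e F))) (subc F)"
      using assms(1) e F by (intro closedin_subc) auto
    show "continuous_on (cdisk (cell_dim K e)) (char_map K e)"
      "inj_on (char_map K e) (odisk (cell_dim K e))"
      using e continuous_char_map inj_on_char_map by auto
    show "subc (insert e F) = subc F \<union> char_map K e ` odisk (cell_dim K e)"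
      by (auto simp: subc_def open_cell_def)
    show "char_map K e ` bsphere (cell_dim K e) \<subseteq> subc F"
      using assms e unfolding lower_closed_def by (intro boundary_subset_subc) auto
    have "{e} - F = {e}" using assms(3) by auto
    then have "subc {e} - subc F = subc {e}"
      using subc_Diff[of "{e}" F] e F by simp
    then show "char_map K e ` odisk (cell_dim K e) \<inter> subc F = {}"
      by (auto simp: subc_def open_cell_def)
  qed
qed

text \<open>Induction on the number of missing cells, which are attached in an order of
  nondecreasing dimension.\<close>

lemma nbhd_extends_subc:
  assumes "lower_closed F" "lower_closed G" "F \<subseteq> G"
  shows "nbhd_extends (subc F) (subc G)"
proof -
  have "finite (G - F)"
    using assms finite_cells finite_subset unfolding lower_closed_def by blast
  then show ?thesis
    using assms
  proof (induction "card (G - F)" arbitrary: G)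
    case 0
    then have "G = F" by auto
    then show ?case by (simp add: nbhd_extends_refl)
  next
    case (Suc m)
    then have "G - F \<noteq> {}" by auto
    \<comment> \<open>The cell \<open>e\<close> taken away from G has the largest dimension among
      the cells outside F. A cell of G of still larger dimension would lie in F and force
      \<open>e\<close> into F, so there is none and \<open>G - {e}\<close> is again lower
      closed.\<close>
    then have "Max (cell_dim K ` (G - F)) \<in> cell_dim K ` (G - F)"
      using Suc.prems by (intro Max_in) auto
    then obtain e where e: "e \<in> G - F" "cell_dim K e = Max (cell_dim K ` (G - F))" by auto
    have le: "cell_dim K e' \<le> cell_dim K e" if "e' \<in> G - F" for e'
      using that Suc.prems e(2) by simp
    have "lower_closed (G - {e})"
      unfolding lower_closed_def
    proof (intro conjI ballI impI)
      show "G - {e} \<subseteq> cells K" using Suc.prems by (auto simp: lower_closed_def)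
      fix a b assume ab: "a \<in> G - {e}" "b \<in> cells K" "cell_dim K b < cell_dim K a"
      then have "b \<in> G" using Suc.prems unfolding lower_closed_def by blast
      moreover have "b \<noteq> e"
      proof
        assume "b = e"
        then have "a \<in> F" using le[of a] ab by (cases "a \<in> F") auto
        then have "e \<in> F" using ab \<open>b = e\<close> Suc.prems(2) unfolding lower_closed_def by blast
        then show False using e by simp
      qed
      ultimately show "b \<in> G - {e}" by simp
    qed
    moreover have "G - {e} - F = (G - F) - {e}" by auto
    moreover have "card ((G - F) - {e}) = m" using Suc.hyps(2) Suc.prems e by simp
    ultimately have "nbhd_extends (subc F) (subc (G - {e}))"
      using Suc e by (intro Suc.hyps(1)) auto
    moreover have "insert e (G - {e}) = G" using e by auto
    then have "nbhd_extends (subc (G - {e})) (subc G)"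
      using nbhd_extends_insert_cell[of "G - {e}" e] \<open>lower_closed (G - {e})\<close> Suc.prems by simp
    ultimately show ?case by (rule nbhd_extends_trans)
  qed
qed

section \<open>Skeleta and paths through cells\<close>

lemma skeleton_eq: "skeleton K j = subc {e \<in> cells K. cell_dim K e \<le> j}"
  by (simp add: skeleton_def subc_def)

lemma lower_closed_skeleton: "lower_closed {e \<in> cells K. cell_dim K e \<le> j}"
  by (auto simp: lower_closed_def)

lemma closed_cell_path:
  assumes "e \<in> cells K" "y \<in> cdisk (cell_dim K e)"
  shows "path (\<lambda>s. char_map K e (scl s y))"
    and "path_image (\<lambda>s. char_map K e (scl s y)) \<subseteq> closed_cell K e"
proof -
  have *: "scl s y \<in> cdisk (cell_dim K e)" if "s \<in> {0..1}" for s
    using that assms(2) scl_in_cdisk by auto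
  then show "path_image (\<lambda>s. char_map K e (scl s y)) \<subseteq> closed_cell K e"
    by (auto simp: path_image_def closed_cell_def)
  have "continuous_on {0..1} (\<lambda>s. scl s y)"
    by (intro continuous_on_scl continuous_on_id continuous_on_const)
  then show "path (\<lambda>s. char_map K e (scl s y))"
    unfolding path_def using *
    by (intro continuous_on_compose2[OF continuous_char_map[OF assms(1)]]) auto
qed

lemma path_component_cell_centre:
  assumes "e \<in> cells K" "x \<in> closed_cell K e"
  shows "path_component X (char_map K e (\<lambda>_. 0)) x"
proof -
  obtain y where y: "y \<in> cdisk (cell_dim K e)" "x = char_map K e y"
    using assms by (auto simp: closed_cell_def)
  have "path_image (\<lambda>s. char_map K e (scl s y)) \<subseteq> X"
    using closed_cell_path(2)[OF assms(1) y(1)] closed_cell_subset[OF assms(1)] by blast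
  moreover have "scl 0 y = (\<lambda>_. 0)" by (simp add: scl_def)
  ultimately show ?thesis
    unfolding path_component_def using closed_cell_path(1)[OF assms(1) y(1)] y(2)
    by (intro exI[of _ "\<lambda>s. char_map K e (scl s y)"]) (auto simp: pathstart_def pathfinish_def)
qed

text \<open>The points reachable from \<open>x0\<close> form a union of closed cells, since radii
  join a closed cell to its centre; so do the remaining points. Both unions are finite and hence
  closed, and connectedness forces the second to be empty.\<close>

lemma path_component_X:
  assumes "connected X" "x0 \<in> X" "x \<in> X"
  shows "path_component X x0 x"
proof (rule ccontr)
  assume x: "\<not> path_component X x0 x"
  define P where "P = {y \<in> X. path_component X x0 y}"
  have cover: "X = (\<Union>e\<in>cells K. closed_cell K e)"
    using subc_eq_closed_cells[OF lower_closed_cells] X_eq by simp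
  have same: "path_component X x0 y \<longleftrightarrow> path_component X x0 (char_map K e (\<lambda>_. 0))"
    if "e \<in> cells K" "y \<in> closed_cell K e" for e y
    using path_component_cell_centre[OF that] by (meson path_component_sym path_component_trans)
  let ?C = "{e \<in> cells K. path_component X x0 (char_map K e (\<lambda>_. 0))}"
  have P: "P = (\<Union>e\<in>?C. closed_cell K e)"
    using cover same by (auto simp: P_def)
  have nP: "X - P = (\<Union>e\<in>cells K - ?C. closed_cell K e)"
    using cover same by (auto simp: P_def)
  have clo: "closedin (top_of_set X) (\<Union>e\<in>C. closed_cell K e)" if "C \<subseteq> cells K" for C
    using that finite_subset[OF that finite_cells] cover compact_closed_cell Hausdorff
    by (intro compact_imp_closedin_Hausdorff compact_UN) auto
  have "closedin (top_of_set X) P" "closedin (top_of_set X) (X - P)"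
    using clo[of ?C] clo[of "cells K - ?C"] P nP by auto
  moreover have P_disj: "P \<inter> (X - P) = {}" "P \<union> (X - P) = X" by (auto simp: P_def)
  ultimately have "P = {} \<or> X - P = {}"
    using assms(1) P_disj unfolding connected_closedin_eq by blast
  moreover have "x0 \<in> P" using assms(2) by (simp add: P_def path_component_refl)
  moreover have "x \<notin> P" using x by (simp add: P_def)
  ultimately show False using assms(3) by blast
qed

text \<open>The path to a point is a fixed path to the centre of a cell, followed by a radius of that
  cell.\<close>

lemma bounded_paths:
  assumes "connected X" "x0 \<in> X"
  obtains p where "\<And>x. x \<in> X \<Longrightarrow> path (p x)" "\<And>x. x \<in> X \<Longrightarrow> path_image (p x) \<subseteq> X"
    "\<And>x. x \<in> X \<Longrightarrow> pathstart (p x) = x0" "\<And>x. x \<in> X \<Longrightarrow> pathfinish (p x) = x"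
    "\<And>\<omega>. closed_one_form X \<omega> \<Longrightarrow> \<exists>B. \<forall>x\<in>X. \<bar>form_integral \<omega> 0 1 (p x)\<bar> \<le> B"
proof -
  have "char_map K e (\<lambda>_. 0) \<in> X" if "e \<in> cells K" for e
  proof -
    have "(\<lambda>_. 0) \<in> cdisk (cell_dim K e)" by (simp add: cdisk_iff sqnorm_def)
    then show ?thesis using closed_cell_subset[OF that] by (auto simp: closed_cell_def)
  qed
  then have "\<exists>q. path q \<and> path_image q \<subseteq> X \<and> pathstart q = x0 \<and>
      pathfinish q = char_map K e (\<lambda>_. 0)" if "e \<in> cells K" for e
    using path_component_X[OF assms] that unfolding path_component_def by blast
  then obtain q where q: "\<And>e. e \<in> cells K \<Longrightarrow> path (q e)" "\<And>e. e \<in> cells K \<Longrightarrow> path_image (q e) \<subseteq> X"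
    "\<And>e. e \<in> cells K \<Longrightarrow> pathstart (q e) = x0"
    "\<And>e. e \<in> cells K \<Longrightarrow> pathfinish (q e) = char_map K e (\<lambda>_. 0)"
    by metis
  \<comment> \<open>Cell and disk coordinate are merely chosen for each x, without continuity.
    Integrals stay bounded because there are finitely many cells and the radii of each are
    parametrised by a compact disk.\<close>
  have "\<exists>e y. e \<in> cells K \<and> y \<in> cdisk (cell_dim K e) \<and> x = char_map K e y" if "x \<in> X" for x
    using that subc_eq_closed_cells[OF lower_closed_cells] X_eq by (auto simp: closed_cell_def)
  then obtain E Y where EY: "\<And>x. x \<in> X \<Longrightarrow> E x \<in> cells K"
    "\<And>x. x \<in> X \<Longrightarrow> Y x \<in> cdisk (cell_dim K (E x))" "\<And>x. x \<in> X \<Longrightarrow> char_map K (E x) (Y x) = x"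
    by metis
  let ?r = "\<lambda>e y s. char_map K e (scl s y)"
  have r0: "pathstart (?r e y) = char_map K e (\<lambda>_. 0)" "pathfinish (?r e y) = char_map K e y" for e y
    by (simp_all add: pathstart_def pathfinish_def) (simp add: scl_def)
  have r: "path (?r e y)" "path_image (?r e y) \<subseteq> X"
    if "e \<in> cells K" "y \<in> cdisk (cell_dim K e)" for e y
    using closed_cell_path[OF that] closed_cell_subset[OF that(1)] by auto
  show ?thesis
  proof (rule that[of "\<lambda>x. q (E x) +++ ?r (E x) (Y x)"])
    fix x assume x: "x \<in> X"
    show "path (q (E x) +++ ?r (E x) (Y x))"
      using x q EY r r0 by (intro path_join_imp) auto
    show "path_image (q (E x) +++ ?r (E x) (Y x)) \<subseteq> X"
      using x q EY r r0 by (subst path_image_join) auto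
    show "pathstart (q (E x) +++ ?r (E x) (Y x)) = x0" using x q EY by simp
    show "pathfinish (q (E x) +++ ?r (E x) (Y x)) = x" using x r0 EY by simp
  next
    \<comment> \<open>The paths were fixed before the form, so the same system serves two forms at
      once.\<close>
    fix \<omega> assume \<omega>: "closed_one_form X \<omega>"
    have "\<exists>B. \<forall>y\<in>cdisk (cell_dim K e). \<bar>form_integral \<omega> 0 1 (?r e y)\<bar> \<le> B" if e: "e \<in> cells K" for e
    proof -
      let ?D = "cdisk (cell_dim K e)"
      have "continuous_on (?D \<times> {0..1}) (\<lambda>p. char_map K e (scl (snd p) (fst p)))"
        using e scl_in_cdisk
        by (intro continuous_on_compose2[OF continuous_char_map[OF e]] continuous_on_scl
            continuous_on_fst continuous_on_snd continuous_on_id) auto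
      moreover have "(\<lambda>p. char_map K e (scl (snd p) (fst p))) ` (?D \<times> {0..1}) \<subseteq> X"
        using closed_cell_subset[OF e] scl_in_cdisk by (auto simp: closed_cell_def)
      ultimately obtain B where B: "\<And>y t. y \<in> ?D \<Longrightarrow> t \<in> {0..1} \<Longrightarrow>
          \<bar>form_integral \<omega> 0 t (\<lambda>s. char_map K e (scl (snd (y, s)) (fst (y, s))))\<bar> \<le> B"
        using compact_cdisk zero_le_one by (rule form_integral_family_bounded[OF \<omega>]) (rule that)
      then show ?thesis using B[of _ 1] by (intro exI[of _ B]) auto
    qed
    then obtain B where B: "\<And>e y. e \<in> cells K \<Longrightarrow> y \<in> cdisk (cell_dim K e) \<Longrightarrow>
        \<bar>form_integral \<omega> 0 1 (?r e y)\<bar> \<le> B e"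
      by metis
    let ?B = "\<Sum>e\<in>cells K. \<bar>form_integral \<omega> 0 1 (q e)\<bar> + \<bar>B e\<bar>"
    have "\<bar>form_integral \<omega> 0 1 (q (E x) +++ ?r (E x) (Y x))\<bar> \<le> ?B" if x: "x \<in> X" for x
    proof -
      have "form_integral \<omega> 0 1 (q (E x) +++ ?r (E x) (Y x)) =
          form_integral \<omega> 0 1 (q (E x)) + form_integral \<omega> 0 1 (?r (E x) (Y x))"
        using x q EY r r0 by (intro form_integral_join[OF \<omega>]) auto
      then have "\<bar>form_integral \<omega> 0 1 (q (E x) +++ ?r (E x) (Y x))\<bar> \<le>
          \<bar>form_integral \<omega> 0 1 (q (E x))\<bar> + \<bar>B (E x)\<bar>"
        using B[OF EY(1)[OF x] EY(2)[OF x]] by linarith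
      also have "\<dots> \<le> ?B"
        using x EY(1) finite_cells
        by (intro member_le_sum[where f = "\<lambda>e. \<bar>form_integral \<omega> 0 1 (q e)\<bar> + \<bar>B e\<bar>"]) auto
      finally show ?thesis .
    qed
    then show "\<exists>B. \<forall>x\<in>X. \<bar>form_integral \<omega> 0 1 (q (E x) +++ ?r (E x) (Y x))\<bar> \<le> B" by blast
  qed
qed

text \<open>The cell shrinks to its centre along radii of the disk, and the constant map there is
  then moved along a path to c, a target that all cells can share.\<close>

lemma null_homotopic_open_cell:
  assumes "e \<in> cells K" "path_component X (char_map K e (\<lambda>_. 0)) c"
  shows "homotopic_with_canon (\<lambda>_. True) (open_cell K e) X (\<lambda>x. x) (\<lambda>_. c)"
proof -
  let ?D = "odisk (cell_dim K e)" and ?f = "char_map K e"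
  obtain g where g: "homeomorphism ?D (open_cell K e) ?f g"
    using open_cell_homeomorphism[OF assms(1)] by blast
  have sub: "?f ` ?D \<subseteq> X"
    using closed_cell_subset[OF assms(1)] by (auto simp: closed_cell_eq open_cell_def)
  have "homotopic_with_canon (\<lambda>_. True) ?D X (\<lambda>y. ?f y) (\<lambda>_. ?f (\<lambda>_. 0))"
  proof (subst homotopic_with, simp, intro exI conjI ballI)
    let ?h = "\<lambda>p. ?f (scl (1 - fst p) (snd p))"
    have im: "scl (1 - fst p) (snd p) \<in> ?D" if "p \<in> {0..1} \<times> ?D" for p
      using that by (auto intro: scl_in_odisk)
    have "continuous_on ({0..1} \<times> ?D) ?h"
      by (rule continuous_on_compose2[OF continuous_char_map[OF assms(1)]])
        (use im in \<open>auto simp: cdisk_eq intro!: continuous_on_scl continuous_on_diff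
           continuous_on_const continuous_on_fst continuous_on_snd continuous_on_id\<close>)
    then show "continuous_map (prod_topology (top_of_set {0..1}) (top_of_set ?D)) (top_of_set X) ?h"
      using sub im by (auto simp: continuous_map_in_subtopology)
  qed (auto simp: scl_def)
  then have "homotopic_with_canon (\<lambda>_. True) (open_cell K e) X ((\<lambda>y. ?f y) \<circ> g) ((\<lambda>_. ?f (\<lambda>_. 0)) \<circ> g)"
    using g by (intro homotopic_with_compose_continuous_right) (auto simp: homeomorphism_def)
  then have "homotopic_with_canon (\<lambda>_. True) (open_cell K e) X (\<lambda>x. x) (\<lambda>_. ?f (\<lambda>_. 0))"
    by (rule homotopic_with_eq) (use g in \<open>auto simp: homeomorphism_def\<close>)
  moreover have "homotopic_with_canon (\<lambda>_. True) (open_cell K e) X (\<lambda>_. ?f (\<lambda>_. 0)) (\<lambda>_. c)"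
    using assms(2) by (simp add: homotopic_constant_maps)
  ultimately show ?thesis by (rule homotopic_with_trans)
qed

lemma null_homotopic_cells:
  assumes "connected X" "c \<in> X"
  obtains V where "openin (top_of_set X) V" "null_homotopic_in X V"
    "subc {e \<in> cells K. cell_dim K e = d} \<subseteq> V"
proof -
  let ?F = "{e \<in> cells K. cell_dim K e \<le> d}" and ?D = "{e \<in> cells K. cell_dim K e = d}"
  \<comment> \<open>Deleting any set of d-cells from the d-skeleton leaves a closed subcomplex. This
    is applied to single cells and to all d-cells together.\<close>
  have op: "openin (top_of_set (subc ?F)) (subc E)" if "E \<subseteq> ?D" for E
  proof -
    have "lower_closed (?F - E)" using that by (auto simp: lower_closed_def)
    then have "closedin (top_of_set (subc ?F)) (subc (?F - E))"
      by (intro closedin_subc) auto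
    moreover have "subc E = subc ?F - subc (?F - E)"
    proof -
      have "?F - (?F - E) = E" using that by auto
      then show ?thesis using subc_Diff[of ?F "?F - E"] by auto
    qed
    ultimately show ?thesis by (simp add: openin_diff)
  qed
  have DF: "subc ?D \<subseteq> subc ?F" by (rule subc_mono) auto
  have centre: "path_component X (char_map K e (\<lambda>_. 0)) c" if "e \<in> cells K" for e
  proof -
    have "(\<lambda>_. 0) \<in> cdisk (cell_dim K e)" by (simp add: cdisk_iff sqnorm_def)
    then have "char_map K e (\<lambda>_. 0) \<in> X"
      using closed_cell_subset[OF that] by (auto simp: closed_cell_def)
    then show ?thesis using path_component_X assms by blast
  qed
  have hom: "homotopic_with_canon (\<lambda>_. True) (subc ?D) X (\<lambda>x. x) (\<lambda>_. c)"
    unfolding subc_def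
  proof (rule homotopic_with_canon_disjoint_opens)
    show "disjoint_family_on (open_cell K) ?D"
      using disjoint_cells by (rule disjoint_family_on_mono[rotated]) auto
    show "openin (top_of_set (\<Union>e\<in>?D. open_cell K e)) (open_cell K e)" if "e \<in> ?D" for e
    proof -
      have "openin (top_of_set (subc ?F)) (subc {e})" using that by (intro op) auto
      then have "openin (top_of_set (subc ?D)) (subc {e})"
        using DF that subc_mono[of "{e}" ?D] by (elim openin_subset_trans) auto
      then show ?thesis by (simp add: subc_def)
    qed
  qed (use null_homotopic_open_cell centre in auto)
  have "nbhd_extends (subc ?F) X"
    using nbhd_extends_subc[of ?F "cells K"] lower_closed_skeleton lower_closed_cells X_eq by simp
  then obtain V f where V: "openin (top_of_set X) V" "subc ?D \<subseteq> V" "f ` V \<subseteq> subc ?D"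
    "homotopic_with_canon (\<lambda>_. True) V X (\<lambda>x. x) f"
    using op[of ?D] by (auto elim: nbhd_extendsE)
  have "continuous_on V f"
    using homotopic_with_imp_continuous_maps[OF V(4)] by (simp add: continuous_map_in_subtopology)
  then have "homotopic_with_canon (\<lambda>_. True) V X ((\<lambda>x. x) \<circ> f) ((\<lambda>_. c) \<circ> f)"
    using V(3) by (intro homotopic_with_compose_continuous_right[OF hom]) auto
  then have "homotopic_with_canon (\<lambda>_. True) V X (\<lambda>x. x) (\<lambda>_. c)"
    using homotopic_with_trans[OF V(4)] by (simp add: o_def)
  then show ?thesis using that V unfolding null_homotopic_in_def by blast
qed

text \<open>Normality of the compact Hausdorff space X puts a closed neighbourhood C of the skeleton
  inside the thickening W. Restricting the deformation to C gives a compact family of paths, whose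
  integrals are bounded.\<close>

lemma deformable_skeleton_nbhd:
  obtains U C and r :: "'a \<times> real \<Rightarrow> 'a" where "openin (top_of_set X) U" "skeleton K k \<subseteq> U" "U \<subseteq> C" "compact C"
    "continuous_on (C \<times> {0..1}) r" "r ` (C \<times> {0..1}) \<subseteq> X"
    "\<And>x. x \<in> C \<Longrightarrow> r (x, 0) = x" "\<And>x. x \<in> C \<Longrightarrow> r (x, 1) \<in> skeleton K k"
proof -
  let ?S = "skeleton K k"
  have "nbhd_extends ?S X"
    using nbhd_extends_subc[OF lower_closed_skeleton lower_closed_cells] X_eq
    by (auto simp: skeleton_eq)
  then obtain W f where W: "openin (top_of_set X) W" "?S \<subseteq> W" "f ` W \<subseteq> ?S"
    "homotopic_with_canon (\<lambda>_. True) W X (\<lambda>x. x) f"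
    by (rule nbhd_extendsE[of _ _ ?S]) auto
  have "\<exists>h. continuous_map (top_of_set ({0..1::real} \<times> W)) (top_of_set X) h \<and>
      (\<forall>x. h (0, x) = x) \<and> (\<forall>x. h (1, x) = f x)"
    using W(4) by (simp add: homotopic_with_def)
  then obtain h where h: "continuous_map (top_of_set ({0..1::real} \<times> W)) (top_of_set X) h"
    "\<And>x. h (0, x) = x" "\<And>x. h (1, x) = f x"
    by metis
  have normal: "normal_space (top_of_set X)"
    using compact_X Hausdorff
    by (intro compact_Hausdorff_or_regular_imp_normal_space) (auto intro: compact_space_subtopology)
  have "closedin (top_of_set (subc (cells K))) ?S"
    unfolding skeleton_eq by (intro closedin_subc lower_closed_skeleton) auto
  then have "closedin (top_of_set X) ?S" by (simp flip: X_eq)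
  then have "\<exists>U. openin (top_of_set X) U \<and> ?S \<subseteq> U \<and> top_of_set X closure_of U \<subseteq> W"
    using normal[unfolded normal_space_alt, THEN spec, THEN spec, THEN mp] W(1,2) by simp
  then obtain U where U: "openin (top_of_set X) U" "?S \<subseteq> U" "top_of_set X closure_of U \<subseteq> W"
    by metis
  let ?C = "top_of_set X closure_of U"
  have "closedin (top_of_set X) ?C" by simp
  then have C: "compact ?C" "?C \<subseteq> X"
    using compact_X closedin_compact closedin_imp_subset by blast+
  have h': "continuous_on ({0..1} \<times> W) h" "h ` ({0..1} \<times> W) \<subseteq> X"
    using h(1) by (auto simp: continuous_map_in_subtopology)
  show ?thesis
  proof (rule that[of U ?C "\<lambda>(x, t). h (t, x)"])
    show "U \<subseteq> ?C" using U(1) by (intro closure_of_subset) (simp add: openin_imp_subset)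
    show "continuous_on (?C \<times> {0..1}) (\<lambda>(x, t). h (t, x))"
      unfolding case_prod_beta
      by (rule continuous_on_compose2[OF h'(1)]) (use U(3) in \<open>auto intro!: continuous_intros\<close>)
    show "(\<lambda>(x, t). h (t, x)) ` (?C \<times> {0..1}) \<subseteq> X" using h'(2) U(3) by auto
    show "(case (x, 1) of (x, t) \<Rightarrow> h (t, x)) \<in> ?S" if "x \<in> ?C" for x
      using that W(3) U(3) h(3) by (auto simp: image_subset_iff)
  qed (use U C h in auto)
qed

end

section \<open>Iterating a homotopy\<close>

locale self_homotopy =
  fixes X S :: "'a::topological_space set" and H :: "'a \<times> real \<Rightarrow> 'a"
  assumes continuous_H: "continuous_on (S \<times> {0..1}) H" and H_in: "H ` (S \<times> {0..1}) \<subseteq> X"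
    and H_0: "\<And>x. x \<in> S \<Longrightarrow> H (x, 0) = x" and H_1: "\<And>x. x \<in> S \<Longrightarrow> H (x, 1) \<in> S"
begin

definition end_map :: "'a \<Rightarrow> 'a" where
  "end_map x = H (x, 1)"

definition iter_flow :: "'a \<times> real \<Rightarrow> 'a" where
  "iter_flow p = H ((end_map ^^ nat \<lfloor>snd p\<rfloor>) (fst p), snd p - of_int \<lfloor>snd p\<rfloor>)"

lemma end_map_iter_in: "x \<in> S \<Longrightarrow> (end_map ^^ m) x \<in> S"
  by (induction m) (auto simp: end_map_def H_1)

lemma continuous_end_map_iter: "continuous_on S (end_map ^^ m)"
proof (induction m)
  case (Suc m)
  have "continuous_on S (\<lambda>x. H ((end_map ^^ m) x, 1))"
    by (rule continuous_on_compose2[OF continuous_H])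
      (use Suc end_map_iter_in in \<open>auto intro!: continuous_intros\<close>)
  moreover have "end_map ^^ Suc m = (\<lambda>x. H ((end_map ^^ m) x, 1))"
    by (simp add: fun_eq_iff end_map_def)
  ultimately show ?case by (simp only:)
qed simp

text \<open>The formula of round m still holds at its right end point, because the next round starts
  with H (y, 0) = y. The closed time intervals obtained in this way are those used for
  pasting.\<close>

lemma iter_flow_eq:
  assumes "x \<in> S" "real m \<le> t" "t \<le> real m + 1"
  shows "iter_flow (x, t) = H ((end_map ^^ m) x, t - m)"
proof (cases "t = real m + 1")
  case True
  then have "\<lfloor>t\<rfloor> = int (Suc m)" by linarith
  then have "iter_flow (x, t) = H ((end_map ^^ Suc m) x, 0)"
    using True by (simp add: iter_flow_def nat_add_distrib del: funpow.simps)
  also have "\<dots> = (end_map ^^ Suc m) x" by (intro H_0 end_map_iter_in assms)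
  finally show ?thesis using True by (simp add: end_map_def)
next
  case False
  then have "\<lfloor>t\<rfloor> = int m" using assms by linarith
  then show ?thesis by (simp add: iter_flow_def)
qed

text \<open>The strips S \<times> [m, m + 1] are closed and locally finite, so continuity on each
  strip suffices.\<close>

lemma continuous_iter_flow: "continuous_on (S \<times> {0..}) iter_flow"
proof -
  have "continuous_map (top_of_set (S \<times> {0..})) euclidean iter_flow"
  proof (rule pasting_lemma_locally_finite[where I = UNIV and T = "\<lambda>m::nat. S \<times> {real m..real m + 1}"
        and f = "\<lambda>_. iter_flow"])
    fix m :: nat
    have "(S \<times> {0..}) \<inter> (S \<times> {real m..real m + 1}) = S \<times> {real m..real m + 1}" by auto
    moreover have "continuous_on (S \<times> {real m..real m + 1}) iter_flow"
    proof -
      have "continuous_on (S \<times> {real m..real m + 1}) (\<lambda>p. (end_map ^^ m) (fst p))"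
        by (rule continuous_on_compose2[OF continuous_end_map_iter]) (auto intro!: continuous_intros)
      then have "continuous_on (S \<times> {real m..real m + 1})
          (\<lambda>p. H ((end_map ^^ m) (fst p), snd p - real m))"
        by (intro continuous_on_compose2[OF continuous_H] continuous_on_Pair continuous_on_diff
            continuous_on_snd continuous_on_id continuous_on_const)
          (auto simp: end_map_iter_in)
      then show ?thesis by (rule continuous_on_eq) (auto simp: iter_flow_eq)
    qed
    ultimately show "continuous_map (subtopology (top_of_set (S \<times> {0..})) (S \<times> {real m..real m + 1}))
        euclidean iter_flow"
      by (simp add: subtopology_subtopology)
    have "closedin (top_of_set {0..}) {real m..real m + 1}"
      by (rule closed_subset) auto
    then show "closedin (top_of_set (S \<times> {0..})) (S \<times> {real m..real m + 1})"
      by (intro closedin_Times) auto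
  next
    fix p assume "p \<in> topspace (top_of_set (S \<times> {0::real..}))"
    then obtain x t where p: "p = (x, t)" "x \<in> S" "0 \<le> t" by auto
    let ?V = "(S \<times> {0..}) \<inter> (UNIV \<times> {..<t + 1})"
    have "open (UNIV \<times> {..<t + 1} :: ('a \<times> real) set)" by (intro open_Times) auto
    then have "openin (top_of_set (S \<times> {0..})) ?V" by (rule openin_open_Int)
    moreover have "{i \<in> UNIV. (S \<times> {real i..real i + 1}) \<inter> ?V \<noteq> {}} \<subseteq> {..nat \<lceil>t + 1\<rceil>}"
    proof
      fix i assume "i \<in> {i \<in> UNIV. (S \<times> {real i..real i + 1}) \<inter> ?V \<noteq> {}}"
      then have "real i \<le> t + 1" by auto
      then have "int i \<le> \<lceil>t + 1\<rceil>" by linarith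
      then show "i \<in> {..nat \<lceil>t + 1\<rceil>}" by simp
    qed
    then have "finite {i \<in> UNIV. (S \<times> {real i..real i + 1}) \<inter> ?V \<noteq> {}}"
      by (rule finite_subset) simp
    ultimately show "\<exists>V. openin (top_of_set (S \<times> {0..})) V \<and> p \<in> V \<and>
        finite {i \<in> UNIV. (S \<times> {real i..real i + 1}) \<inter> V \<noteq> {}}"
      using p by (intro exI[of _ ?V]) auto
  next
    fix p assume "p \<in> topspace (top_of_set (S \<times> {0::real..}))"
    then obtain x t where p: "p = (x, t)" "x \<in> S" "0 \<le> t" by auto
    have "t \<in> {real (nat \<lfloor>t\<rfloor>)..real (nat \<lfloor>t\<rfloor>) + 1}" using p(3) by simp
    then show "\<exists>j. j \<in> UNIV \<and> p \<in> S \<times> {real j..real j + 1} \<and> iter_flow p = iter_flow p"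
      using p by blast
  qed simp
  then show ?thesis by simp
qed

lemma iter_flow_in:
  assumes "x \<in> S" "0 \<le> t"
  shows "iter_flow (x, t) \<in> X"
proof -
  have "0 \<le> t - \<lfloor>t\<rfloor>" "t - \<lfloor>t\<rfloor> \<le> 1" by linarith+
  then show ?thesis
    using H_in end_map_iter_in[OF assms(1)] by (auto simp: iter_flow_def)
qed

lemma iter_flow_0: "x \<in> S \<Longrightarrow> iter_flow (x, 0) = x"
  by (simp add: iter_flow_def H_0)

lemma iter_flow_integral_piece:
  assumes "closed_one_form X \<omega>" "x \<in> S" "real m \<le> t" "t \<le> real m + 1"
  shows "form_integral \<omega> m t (\<lambda>s. iter_flow (x, s)) =
    form_integral \<omega> 0 (t - m) (\<lambda>s. H ((end_map ^^ m) x, s))"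
proof (rule form_integral_reparam[where \<phi> = "\<lambda>s. s - real m", OF assms(1)])
  show "continuous_on {0..t - real m} (\<lambda>s. H ((end_map ^^ m) x, s))"
    by (rule continuous_on_compose2[OF continuous_H])
      (use end_map_iter_in assms in \<open>auto intro!: continuous_intros\<close>)
  show "(\<lambda>s. H ((end_map ^^ m) x, s)) ` {0..t - real m} \<subseteq> X"
    using H_in end_map_iter_in[OF assms(2), of m] assms by auto
  show "iter_flow (x, s) = H ((end_map ^^ m) x, s - m)" if "s \<in> {real m..t}" for s
    using assms that by (intro iter_flow_eq) auto
qed (use assms in \<open>auto intro!: continuous_intros\<close>)

text \<open>Every completed round contributes at least \<epsilon>, because it starts at a point of S
  again; the unfinished round is bounded by compactness of S.\<close>

lemma iter_flow_integral_ge: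
  assumes \<omega>: "closed_one_form X \<omega>" and "compact S" "0 \<le> \<epsilon>"
    and ge: "\<And>x. x \<in> S \<Longrightarrow> \<epsilon> \<le> form_integral \<omega> 0 1 (\<lambda>s. H (x, s))"
  obtains B where "\<And>x t. x \<in> S \<Longrightarrow> 0 \<le> t \<Longrightarrow>
    t * \<epsilon> - B \<le> form_integral \<omega> 0 t (\<lambda>s. iter_flow (x, s))"
proof -
  obtain B where B: "\<And>x t. x \<in> S \<Longrightarrow> t \<in> {0..1} \<Longrightarrow> \<bar>form_integral \<omega> 0 t (\<lambda>s. H (x, s))\<bar> \<le> B"
    using form_integral_family_bounded[OF \<omega> continuous_H H_in assms(2) zero_le_one] by auto
  have comb: "form_integral \<omega> 0 t (\<lambda>s. iter_flow (x, s)) =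
      form_integral \<omega> 0 m (\<lambda>s. iter_flow (x, s)) + form_integral \<omega> m t (\<lambda>s. iter_flow (x, s))"
    if "x \<in> S" "real m \<le> t" for x t m
    using that iter_flow_in
    by (intro form_integral_combine[OF \<omega>] continuous_on_compose2[OF continuous_iter_flow])
      (auto intro!: continuous_intros)
  have nat: "real m * \<epsilon> \<le> form_integral \<omega> 0 m (\<lambda>s. iter_flow (x, s))" if x: "x \<in> S" for x m
  proof (induction m)
    case 0
    \<comment> \<open>Splitting this integral at 0 gives I = I + I.\<close>
    have "form_integral \<omega> 0 0 (\<lambda>s. iter_flow (x, s)) = 0"
      using comb[OF x, of 0 0] by simp
    then show ?case by simp
  next
    case (Suc m)
    have "form_integral \<omega> m (Suc m) (\<lambda>s. iter_flow (x, s)) =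
        form_integral \<omega> 0 1 (\<lambda>s. H ((end_map ^^ m) x, s))"
      using iter_flow_integral_piece[OF \<omega> x, of m "Suc m"] by simp
    then show ?case
      using Suc comb[OF x, of m "Suc m"] ge[OF end_map_iter_in[OF x, of m]]
      by (simp add: algebra_simps)
  qed
  show ?thesis
  \<comment> \<open>B pays for the unfinished round and \<epsilon> for rounding t down to whole
    rounds, as t \<le> m + 1.\<close>
  proof (rule that[of "B + \<epsilon>"])
    fix x t assume x: "x \<in> S" and t: "(0::real) \<le> t"
    have "real (nat \<lfloor>t\<rfloor>) \<le> t" "t \<le> real (nat \<lfloor>t\<rfloor>) + 1" using t by linarith+
    then obtain m where m: "real m \<le> t" "t \<le> real m + 1" by blast
    have "\<bar>form_integral \<omega> m t (\<lambda>s. iter_flow (x, s))\<bar> \<le> B"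
      unfolding iter_flow_integral_piece[OF \<omega> x m] using m by (intro B end_map_iter_in x) auto
    moreover have "t * \<epsilon> \<le> (real m + 1) * \<epsilon>" using m assms(3) by (intro mult_right_mono) auto
    ultimately show "t * \<epsilon> - (B + \<epsilon>) \<le> form_integral \<omega> 0 t (\<lambda>s. iter_flow (x, s))"
      using nat[OF x, of m] comb[OF x m(1)] by (simp add: algebra_simps abs_le_iff)
  qed
qed

end

section \<open>The flow near the skeleton, change of form, and the cover of the complement\<close>

lemma (in finite_cw) flow_near_skeleton:
  assumes \<omega>: "closed_one_form X \<omega>"
    and H: "continuous_on (skeleton K k \<times> {0..1}) H" "H ` (skeleton K k \<times> {0..1}) \<subseteq> X"
    and "\<And>x. x \<in> skeleton K k \<Longrightarrow> H (x, 0) = x" "\<And>x. x \<in> skeleton K k \<Longrightarrow> H (x, 1) \<in> skeleton K k"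
    and "0 \<le> \<epsilon>" "\<And>x. x \<in> skeleton K k \<Longrightarrow> \<epsilon> \<le> form_integral \<omega> 0 1 (\<lambda>s. H (x, s))"
  obtains U h A where "openin (top_of_set X) U" "skeleton K k \<subseteq> U"
    "continuous_on (U \<times> {0..}) h" "h ` (U \<times> {0..}) \<subseteq> X" "\<And>x. x \<in> U \<Longrightarrow> h (x, 0) = x"
    "\<And>x t. x \<in> U \<Longrightarrow> 1 \<le> t \<Longrightarrow> t * \<epsilon> - A \<le> form_integral \<omega> 0 t (\<lambda>s. h (x, s))"
proof -
  let ?S = "skeleton K k"
  interpret self_homotopy X ?S H by unfold_locales (use assms in auto)
  obtain U C and r :: "'a \<times> real \<Rightarrow> 'a" where U: "openin (top_of_set X) U" "?S \<subseteq> U" "U \<subseteq> C" "compact C"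
    and r: "continuous_on (C \<times> {0..1}) r" "r ` (C \<times> {0..1}) \<subseteq> X"
    "\<And>x. x \<in> C \<Longrightarrow> r (x, 0) = x" "\<And>x. x \<in> C \<Longrightarrow> r (x, 1) \<in> ?S"
    by (rule deformable_skeleton_nbhd[of k]) blast
  have "compact ?S" unfolding skeleton_eq by (rule compact_subc[OF lower_closed_skeleton])
  then obtain B where B: "\<And>x t. x \<in> ?S \<Longrightarrow> 0 \<le> t \<Longrightarrow>
      t * \<epsilon> - B \<le> form_integral \<omega> 0 t (\<lambda>s. iter_flow (x, s))"
    using iter_flow_integral_ge[OF \<omega>, of \<epsilon>] assms(6,7) by blast
  obtain B' where B': "\<And>x t. x \<in> C \<Longrightarrow> t \<in> {0..1} \<Longrightarrow> \<bar>form_integral \<omega> 0 t (\<lambda>s. r (x, s))\<bar> \<le> B'"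
    using form_integral_family_bounded[OF \<omega> r(1,2) U(4) zero_le_one] by auto
  \<comment> \<open>One unit of time is spent on the deformation into the skeleton, then the
    iterated flow starts. At time 1 both branches give r (x, 1).\<close>
  define h where "h = (\<lambda>p. if snd p \<le> 1 then r p else iter_flow (r (fst p, 1), snd p - 1))"
  have h_lo: "h (x, t) = r (x, t)" if "t \<le> 1" for x t using that by (simp add: h_def)
  have h_hi: "h (x, t) = iter_flow (r (x, 1), t - 1)" if "x \<in> U" "1 \<le> t" for x t
  proof (cases "t = 1")
    case True
    then show ?thesis using that U(3) r(4)[of x] iter_flow_0 by (auto simp: h_def)
  qed (use that in \<open>simp add: h_def\<close>)
  have r1: "r (x, 1) \<in> ?S" if "x \<in> U" for x using that U(3) r(4) by auto
  have cont: "continuous_on (U \<times> {0..}) h"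
  proof -
    have "continuous_on (U \<times> {0..1}) h"
      by (rule continuous_on_eq[OF continuous_on_subset[OF r(1)]]) (use U(3) in \<open>auto simp: h_lo\<close>)
    moreover have "continuous_on (U \<times> {1..}) h"
    proof -
      have "continuous_on (U \<times> {1..}) (\<lambda>p. r (fst p, 1))"
        by (rule continuous_on_compose2[OF r(1)]) (use U(3) in \<open>auto intro!: continuous_intros\<close>)
      then have "continuous_on (U \<times> {1..}) (\<lambda>p. iter_flow (r (fst p, 1), snd p - 1))"
        by (intro continuous_on_compose2[OF continuous_iter_flow] continuous_on_Pair continuous_on_diff
            continuous_on_snd continuous_on_id continuous_on_const) (auto simp: r1)
      then show ?thesis by (rule continuous_on_eq) (auto simp: h_hi)
    qed
    moreover have "(U \<times> {0..1}) \<union> (U \<times> {1..}) = U \<times> {0::real..}" by auto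
    moreover have "closedin (top_of_set {0..}) {0..1::real}" "closedin (top_of_set {0..}) {1::real..}"
      by (auto intro: closed_subset)
    then have "closedin (top_of_set (U \<times> {0..})) (U \<times> {0..1::real})"
      "closedin (top_of_set (U \<times> {0..})) (U \<times> {1::real..})"
      by (simp_all add: closedin_Times)
    ultimately show ?thesis using continuous_on_Un_local[of "U \<times> {0..1}" "U \<times> {1..}" h] by simp
  qed
  have im: "h (x, t) \<in> X" if "x \<in> U" "0 \<le> t" for x t
  proof (cases "t \<le> 1")
    case True
    then have "(x, t) \<in> C \<times> {0..1}" using that U(3) by auto
    then show ?thesis using r(2) True by (auto simp: h_lo image_subset_iff)
  next
    case False
    then show ?thesis using that h_hi[of x t] r1 iter_flow_in by auto
  qed
  have ch: "continuous_on {a..b} (\<lambda>s. h (x, s))" "(\<lambda>s. h (x, s)) ` {a..b} \<subseteq> X"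
    if "x \<in> U" "0 \<le> a" for x a b
    using that im
    by (auto intro!: continuous_on_compose2[OF cont] continuous_intros)
  \<comment> \<open>B and B' bound the losses of the iterated flow and of the deformation; the extra
    \<epsilon> accounts for the initial unit of time, in which no gain is guaranteed.\<close>
  have "t * \<epsilon> - (B + B' + \<epsilon>) \<le> form_integral \<omega> 0 t (\<lambda>s. h (x, s))" if x: "x \<in> U" and t: "1 \<le> t" for x t
  proof -
    have xC: "x \<in> C" using x U(3) by auto
    have "form_integral \<omega> 0 t (\<lambda>s. h (x, s)) =
        form_integral \<omega> 0 1 (\<lambda>s. h (x, s)) + form_integral \<omega> 1 t (\<lambda>s. h (x, s))"
      using x t by (intro form_integral_combine[OF \<omega>] ch) auto
    moreover have "form_integral \<omega> 0 1 (\<lambda>s. h (x, s)) = form_integral \<omega> 0 1 (\<lambda>s. r (x, s))"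
      using xC r(2)
      by (intro form_integral_cong[OF \<omega>])
        (auto simp: h_lo intro!: continuous_on_compose2[OF r(1)] continuous_intros)
    moreover have "form_integral \<omega> 1 t (\<lambda>s. h (x, s)) =
        form_integral \<omega> 0 (t - 1) (\<lambda>s. iter_flow (r (x, 1), s))"
    proof (rule form_integral_reparam[where \<phi> = "\<lambda>s. s - 1", OF \<omega>])
      show "continuous_on {0..t - 1} (\<lambda>s. iter_flow (r (x, 1), s))"
        by (rule continuous_on_compose2[OF continuous_iter_flow])
          (use r1 x in \<open>auto intro!: continuous_intros\<close>)
    qed (use t x r1 h_hi iter_flow_in in \<open>auto intro!: continuous_intros\<close>)
    ultimately show ?thesis
      using B[OF r1[OF x], of "t - 1"] B'[OF xC, of 1] t by (simp add: algebra_simps abs_le_iff)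
  qed
  moreover have "h ` (U \<times> {0..}) \<subseteq> X" using im by auto
  moreover have "h (x, 0) = x" if "x \<in> U" for x using that U(3) r(3) by (auto simp: h_lo)
  ultimately show ?thesis using that[OF U(1,2) cont] by blast
qed

text \<open>Up to sign the two forms differ by an exact form, whose primitive is bounded on a compact
  space.\<close>

lemma (in finite_cw) form_integral_opposite_periods:
  assumes "connected X" "x0 \<in> X" and \<omega>: "closed_one_form X \<omega>" and \<omega>': "closed_one_form X \<omega>'"
    and loops: "\<And>p. p \<in> loops_at X x0 \<Longrightarrow> form_integral \<omega>' 0 1 p = - form_integral \<omega> 0 1 p"
  obtains M where "\<And>\<gamma> t. 0 \<le> t \<Longrightarrow> continuous_on {0..t} \<gamma> \<Longrightarrow> \<gamma> ` {0..t} \<subseteq> X \<Longrightarrow>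
    form_integral \<omega>' 0 t \<gamma> \<le> M - form_integral \<omega> 0 t \<gamma>"
proof -
  obtain p where p: "\<And>x. x \<in> X \<Longrightarrow> path (p x)" "\<And>x. x \<in> X \<Longrightarrow> path_image (p x) \<subseteq> X"
    "\<And>x. x \<in> X \<Longrightarrow> pathstart (p x) = x0" "\<And>x. x \<in> X \<Longrightarrow> pathfinish (p x) = x"
    and bound: "\<And>\<omega>. closed_one_form X \<omega> \<Longrightarrow> \<exists>B. \<forall>x\<in>X. \<bar>form_integral \<omega> 0 1 (p x)\<bar> \<le> B"
    by (rule bounded_paths[OF assms(1,2)]) blast
  obtain B B' where B: "\<And>x. x \<in> X \<Longrightarrow> \<bar>form_integral \<omega> 0 1 (p x)\<bar> \<le> B"
    "\<And>x. x \<in> X \<Longrightarrow> \<bar>form_integral \<omega>' 0 1 (p x)\<bar> \<le> B'"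
    using bound[OF \<omega>] bound[OF \<omega>'] by blast
  show ?thesis
  \<comment> \<open>Because the periods are opposite, the two integrals along the path add up to
    four integrals over connecting paths, taken with signs, two for each form.\<close>
  proof (rule that[of "2 * B + 2 * B'"])
    fix \<gamma> and t :: real assume t: "0 \<le> t" and \<gamma>: "continuous_on {0..t} \<gamma>" "\<gamma> ` {0..t} \<subseteq> X"
    let ?g = "\<lambda>s. \<gamma> (t * s)"
    have ts: "t * s \<in> {0..t}" if "s \<in> {0..1}" for s
      using that t mult_left_mono[of s 1 t] by auto
    have g: "path ?g" "path_image ?g \<subseteq> X" "pathstart ?g = \<gamma> 0" "pathfinish ?g = \<gamma> t"
      using ts \<gamma>(2) unfolding path_def path_image_def
      by (auto intro!: continuous_on_compose2[OF \<gamma>(1)] continuous_intros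
          simp: pathstart_def pathfinish_def)
    have ends: "\<gamma> 0 \<in> X" "\<gamma> t \<in> X" using \<gamma>(2) t by auto
    \<comment> \<open>Closing up the path at \<open>x0\<close> reduces the comparison to loops,
      where the two forms are related by hypothesis.\<close>
    let ?l = "p (\<gamma> 0) +++ (?g +++ reversepath (p (\<gamma> t)))"
    have "?l \<in> loops_at X x0"
      using g p ends by (auto simp: loops_at_def path_image_join)
    moreover have "form_integral \<eta> 0 1 ?l = form_integral \<eta> 0 1 (p (\<gamma> 0)) +
        form_integral \<eta> 0 t \<gamma> - form_integral \<eta> 0 1 (p (\<gamma> t))" if \<eta>: "closed_one_form X \<eta>" for \<eta>
    proof -
      have "form_integral \<eta> 0 1 ?l = form_integral \<eta> 0 1 (p (\<gamma> 0)) +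
          form_integral \<eta> 0 1 (?g +++ reversepath (p (\<gamma> t)))"
        using g p ends by (intro form_integral_join[OF \<eta>]) (auto simp: path_image_join)
      also have "form_integral \<eta> 0 1 (?g +++ reversepath (p (\<gamma> t))) =
          form_integral \<eta> 0 1 ?g + form_integral \<eta> 0 1 (reversepath (p (\<gamma> t)))"
        using g p ends by (intro form_integral_join[OF \<eta>]) auto
      also have "form_integral \<eta> 0 1 (reversepath (p (\<gamma> t))) = - form_integral \<eta> 0 1 (p (\<gamma> t))"
        using p ends by (intro form_integral_reverse[OF \<eta>]) auto
      also have "form_integral \<eta> 0 1 ?g = form_integral \<eta> 0 t \<gamma>"
        using t ts by (intro form_integral_reparam[OF \<eta> \<gamma> t, where \<phi> = "\<lambda>s. t * s"])
          (auto intro!: continuous_intros)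
      finally show ?thesis by simp
    qed
    ultimately show "form_integral \<omega>' 0 t \<gamma> \<le> 2 * B + 2 * B' - form_integral \<omega> 0 t \<gamma>"
      using loops \<omega> \<omega>' B[OF ends(1)] B[OF ends(2)] by (fastforce simp: abs_le_iff)
  qed
qed

text \<open>One null-homotopic open set is spent on each dimension d above k; the index j stands for
  d = k + 1 + j.\<close>

lemma (in finite_cw) cat_in_skeleton_complement:
  assumes "connected X" "x0 \<in> X" "skeleton K k \<subseteq> U"
  shows "cat_in X (X - U) \<le> enat (cw_dim K - k)"
proof -
  have "\<exists>V. openin (top_of_set X) V \<and> null_homotopic_in X V \<and>
      subc {e \<in> cells K. cell_dim K e = d} \<subseteq> V" for d
    by (rule null_homotopic_cells[OF assms(1,2)]) blast
  then obtain V where V: "\<And>d. openin (top_of_set X) (V d)" "\<And>d. null_homotopic_in X (V d)"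
    "\<And>d. subc {e \<in> cells K. cell_dim K e = d} \<subseteq> V d"
    by metis
  have "X - U \<subseteq> (\<Union>j<cw_dim K - k. V (Suc (k + j)))"
  proof
    fix x assume x: "x \<in> X - U"
    then have "x \<in> subc (cells K)" using X_eq by auto
    then obtain e where e: "e \<in> cells K" "x \<in> open_cell K e" by (auto simp: subc_def)
    have "cell_dim K e \<le> cw_dim K"
      using e(1) finite_cells by (simp add: cw_dim_def)
    moreover have "\<not> cell_dim K e \<le> k" using e x assms(3) by (auto simp: skeleton_def)
    ultimately have "cell_dim K e - Suc k < cw_dim K - k"
      "Suc (k + (cell_dim K e - Suc k)) = cell_dim K e" by auto
    moreover have "x \<in> V (cell_dim K e)"
      using V(3)[of "cell_dim K e"] e by (auto simp: subc_def)
    ultimately show "x \<in> (\<Union>j<cw_dim K - k. V (Suc (k + j)))"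
      by (metis UN_iff lessThan_iff)
  qed
  then show ?thesis
    unfolding cat_in_def using V(1,2)
    by (intro Inf_lower CollectI exI[of _ "cw_dim K - k"] exI[of _ "\<lambda>j. V (Suc (k + j))"] conjI refl)
      auto
qed

text \<open>At time 1 the k-skeleton gains no dimension in the product, because {1} is a 0-cell of
  the interval. At intermediate times cellularity only confines the homotopy to the (k +
  1)-skeleton, but its end map can be iterated.\<close>

lemma cellular_homotopy_end:
  assumes "cellular (product_skeleton (skeleton (skeleton_complex K k)) interval_skeleton) (skeleton K) H"
    and "x \<in> skeleton K k"
  shows "H (x, 1) \<in> skeleton K k"
proof -
  have "skeleton (skeleton_complex K k) k = skeleton K k"
    by (simp add: skeleton_def skeleton_complex_def open_cell_def)
  then have "(x, 1) \<in> product_skeleton (skeleton (skeleton_complex K k)) interval_skeleton k"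
    using assms(2) unfolding product_skeleton_def interval_skeleton_def
    by (intro UN_I[of k]) auto
  then show ?thesis using assms(1) unfolding cellular_def by blast
qed

theorem theorem5:
  fixes X :: "'a::topological_space set"
    and K :: "('a, 'e) cell_structure"
    and x0 :: 'a
    and \<xi> :: "(real \<Rightarrow> 'a) set \<Rightarrow> real"
    and k n :: nat
  assumes "finite_cw_complex X K"
    and "connected X"
    and "x0 \<in> X"
    and "\<xi> \<in> H1 X x0"
    and "nonzero_class X x0 \<xi>"
    and "n = cw_dim K"
    and "k \<le> n"
    and "(\<lambda>g. - \<xi> g) \<in> Sigma_inv X K x0 k"
  shows "Cat X x0 \<xi> \<le> enat (n - k)"
proof -
  interpret finite_cw X K by unfold_locales (rule assms(1))
  let ?S = "skeleton K k"
  obtain \<omega> \<epsilon> H where rep: "represents X x0 \<omega> (\<lambda>g. - \<xi> g)" and \<epsilon>: "\<epsilon> > 0"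
    and H: "continuous_on (?S \<times> {0..1}) H" "H ` (?S \<times> {0..1}) \<subseteq> X"
    and cell: "cellular (product_skeleton (skeleton (skeleton_complex K k)) interval_skeleton) (skeleton K) H"
    and H0: "\<forall>x\<in>?S. H (x, 0) = x \<and> form_integral \<omega> 0 1 (\<lambda>t. H (x, t)) \<ge> \<epsilon>"
    using assms(8) unfolding Sigma_inv_def by (elim CollectE exE conjE) (rule that)
  have \<omega>: "closed_one_form X \<omega>" using rep by (simp add: represents_def)
  \<comment> \<open>Guarantees that the choice made in \<open>Cat\<close> really yields a
    representative of \<xi>.\<close>
  have "represents X x0 (neg_form \<omega>) \<xi>"
    using rep form_integral_neg_form[OF \<omega>, of 0 1] closed_neg_form[OF \<omega>]
    by (auto simp: represents_def loops_at_def path_def path_image_def)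
  then have "represents X x0 (SOME \<omega>. represents X x0 \<omega> \<xi>) \<xi>" by (rule someI)
  then obtain \<omega>' where \<omega>': "\<omega>' = (SOME \<omega>. represents X x0 \<omega> \<xi>)" "represents X x0 \<omega>' \<xi>" by blast
  have \<omega>'_closed: "closed_one_form X \<omega>'" using \<omega>'(2) by (simp add: represents_def)
  have "form_integral \<omega>' 0 1 p = - form_integral \<omega> 0 1 p" if "p \<in> loops_at X x0" for p
    using that rep \<omega>'(2) by (simp add: represents_def)
  then obtain M where M: "\<And>\<gamma> t. 0 \<le> t \<Longrightarrow> continuous_on {0..t} \<gamma> \<Longrightarrow> \<gamma> ` {0..t} \<subseteq> X \<Longrightarrow>
      form_integral \<omega>' 0 t \<gamma> \<le> M - form_integral \<omega> 0 t \<gamma>"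
    by (rule form_integral_opposite_periods[OF assms(2,3) \<omega> \<omega>'_closed]) (assumption, rule that)
  obtain U h A where U: "openin (top_of_set X) U" "?S \<subseteq> U"
    and h: "continuous_on (U \<times> {0..}) h" "h ` (U \<times> {0..}) \<subseteq> X" "\<And>x. x \<in> U \<Longrightarrow> h (x, 0) = x"
    and A: "\<And>x t. x \<in> U \<Longrightarrow> 1 \<le> t \<Longrightarrow> t * \<epsilon> - A \<le> form_integral \<omega> 0 t (\<lambda>s. h (x, s))"
    by (rule flow_near_skeleton[OF \<omega> H, of \<epsilon>])
      (use H0 \<epsilon> cellular_homotopy_end[OF cell] in auto)
  have unif: "\<forall>\<^sub>F t in at_top. \<forall>x\<in>U. form_integral \<omega>' 0 t (\<lambda>s. h (x, s)) \<le> c" for c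
  \<comment> \<open>From time 1 on the flow estimate is available, and the second term is the time
    at which M - (t * \<epsilon> - A) has dropped to c.\<close>
  proof (rule eventually_at_top_linorderI[of "max 1 ((A + M - c) / \<epsilon>)"], intro ballI)
    fix t x assume t: "max 1 ((A + M - c) / \<epsilon>) \<le> t" and x: "x \<in> U"
    have "continuous_on {0..t} (\<lambda>s. h (x, s))"
      by (rule continuous_on_compose2[OF h(1)]) (use x in \<open>auto intro!: continuous_intros\<close>)
    then have "form_integral \<omega>' 0 t (\<lambda>s. h (x, s)) \<le> M - form_integral \<omega> 0 t (\<lambda>s. h (x, s))"
      using x h(2) t by (intro M) auto
    also have "\<dots> \<le> M - (t * \<epsilon> - A)" using A[OF x, of t] t by linarith
    also have "\<dots> \<le> c" using t \<epsilon> by (simp add: divide_le_eq)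
    finally show "form_integral \<omega>' 0 t (\<lambda>s. h (x, s)) \<le> c" .
  qed
  \<comment> \<open>Pointwise divergence is read off from the uniform bounds.\<close>
  have "filterlim (\<lambda>t. form_integral \<omega>' 0 t (\<lambda>s. h (x, s))) at_bot at_top" if "x \<in> U" for x
    unfolding filterlim_at_bot using that by (intro allI eventually_mono[OF unif]) auto
  then have "Cat_form X \<omega>' \<le> enat (n - k)"
    unfolding Cat_form_def
    using U h unif cat_in_skeleton_complement[OF assms(2,3) U(2)] assms(6)
    by (intro Inf_lower CollectI exI[of _ "n - k"] exI[of _ U] exI[of _ h] conjI refl) auto
  then show ?thesis by (simp add: Cat_def \<omega>'(1))
qed

end
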